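(* Let $Y_1,\dots,Y_k$ be finite dimensional compacta with $n_i=\dim Y_i\geq 1$, let $n=n_1+\cdots+n_k$, let $G$ be an Abelian group, and let $H$ be a proper subgroup of $H^n(Y_1\times\cdots\times Y_k;G)$. Then there exist maps $\varphi_i:Y_i\to \mathbb{S}^{n_i}$, $i=1,\dots,k$, such that the image of $H^n(\varphi_1\times\cdots\times\varphi_k;G):H^n(\mathbb{S}^{n_1}\times\cdots\times\mathbb{S}^{n_k};G)\to H^n(Y_1\times\cdots\times Y_k;G)$ is not contained in $H$.
   Context: A compactum is a compact metric space; maps are continuous. $H^*(\cdot\,;G)$ denotes Čech cohomology with coefficients in $G$; $\mathbb{S}^m$ is the unit $m$-sphere. *)

theory Defs
  imports "HOL-Analysis.Analysis" "HOL-Algebra.FiniteProduct"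
begin

definition fin_open_cover :: "'a topology \<Rightarrow> 'a set set \<Rightarrow> bool" where
  "fin_open_cover X \<U> \<longleftrightarrow> finite \<U> \<and> (\<forall>U\<in>\<U>. openin X U) \<and> \<Union>\<U> = topspace X"

definition cover_dim_le :: "'a topology \<Rightarrow> nat \<Rightarrow> bool" where
  "cover_dim_le X m \<longleftrightarrow>
     (\<forall>\<U>. fin_open_cover X \<U> \<longrightarrow>
        (\<exists>\<V>. fin_open_cover X \<V> \<and> (\<forall>V\<in>\<V>. \<exists>U\<in>\<U>. V \<subseteq> U) \<and>
             (\<forall>x\<in>topspace X. card {V\<in>\<V>. x \<in> V} \<le> Suc m)))"

text \<open>dim X = m (for m \<ge> 1 this forces X nonempty).\<close>
definition cover_dim_eq :: "'a topology \<Rightarrow> nat \<Rightarrow> bool" where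
  "cover_dim_eq X m \<longleftrightarrow> cover_dim_le X m \<and> (m = 0 \<or> \<not> cover_dim_le X (m - 1))"

definition sphere_top :: "nat \<Rightarrow> (nat \<Rightarrow> real) topology" where
  "sphere_top m = subtopology (product_topology (\<lambda>_. euclideanreal) {..m})
                     {x. (\<Sum>j\<le>m. (x j)\<^sup>2) = 1}"

definition nerve_tuples :: "'a topology \<Rightarrow> 'a set set \<Rightarrow> nat \<Rightarrow> 'a set list set" where
  "nerve_tuples X \<U> n = {\<sigma>. length \<sigma> = Suc n \<and> set \<sigma> \<subseteq> \<U> \<and> topspace X \<inter> \<Inter>(set \<sigma>) \<noteq> {}}"

definition cochains :: "'a topology \<Rightarrow> ('g,'m) monoid_scheme \<Rightarrow> 'a set set \<Rightarrow> nat
    \<Rightarrow> ('a set list \<Rightarrow> 'g) set" where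
  "cochains X G \<U> n = {c. (\<forall>\<sigma>\<in>nerve_tuples X \<U> n. c \<sigma> \<in> carrier G) \<and>
                          (\<forall>\<sigma>. \<sigma> \<notin> nerve_tuples X \<U> n \<longrightarrow> c \<sigma> = \<one>\<^bsub>G\<^esub>)}"

definition face :: "nat \<Rightarrow> 'b list \<Rightarrow> 'b list" where
  "face j \<sigma> = take j \<sigma> @ drop (Suc j) \<sigma>"

definition cobdry :: "'a topology \<Rightarrow> ('g,'m) monoid_scheme \<Rightarrow> 'a set set \<Rightarrow> nat
    \<Rightarrow> ('a set list \<Rightarrow> 'g) \<Rightarrow> ('a set list \<Rightarrow> 'g)" where
  "cobdry X G \<U> n c = (\<lambda>\<sigma>. if \<sigma> \<in> nerve_tuples X \<U> (Suc n)
      then finprod G (\<lambda>j. c (face j \<sigma>) [^]\<^bsub>G\<^esub> ((-1::int) ^ j)) {..Suc n}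
      else \<one>\<^bsub>G\<^esub>)"

definition cocycles :: "'a topology \<Rightarrow> ('g,'m) monoid_scheme \<Rightarrow> 'a set set \<Rightarrow> nat
    \<Rightarrow> ('a set list \<Rightarrow> 'g) set" where
  "cocycles X G \<U> n = {c \<in> cochains X G \<U> n. cobdry X G \<U> n c = (\<lambda>_. \<one>\<^bsub>G\<^esub>)}"

definition coboundaries :: "'a topology \<Rightarrow> ('g,'m) monoid_scheme \<Rightarrow> 'a set set \<Rightarrow> nat
    \<Rightarrow> ('a set list \<Rightarrow> 'g) set" where
  "coboundaries X G \<U> n =
     (if n = 0 then {\<lambda>_. \<one>\<^bsub>G\<^esub>} else cobdry X G \<U> (n - 1) ` cochains X G \<U> (n - 1))"

definition cmult :: "('g,'m) monoid_scheme \<Rightarrow> ('b \<Rightarrow> 'g) \<Rightarrow> ('b \<Rightarrow> 'g) \<Rightarrow> ('b \<Rightarrow> 'g)" where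
  "cmult G c d = (\<lambda>\<sigma>. c \<sigma> \<otimes>\<^bsub>G\<^esub> d \<sigma>)"

definition cinv :: "('g,'m) monoid_scheme \<Rightarrow> ('b \<Rightarrow> 'g) \<Rightarrow> ('b \<Rightarrow> 'g)" where
  "cinv G c = (\<lambda>\<sigma>. inv\<^bsub>G\<^esub> (c \<sigma>))"

definition refine_proj :: "'a set set \<Rightarrow> 'a set set \<Rightarrow> ('a set \<Rightarrow> 'a set) \<Rightarrow> bool" where
  "refine_proj \<W> \<U> p \<longleftrightarrow> (\<forall>W\<in>\<W>. p W \<in> \<U> \<and> W \<subseteq> p W)"

definition pull_cochain :: "'a topology \<Rightarrow> ('g,'m) monoid_scheme \<Rightarrow> 'a set set \<Rightarrow> nat
    \<Rightarrow> ('a set \<Rightarrow> 'b set) \<Rightarrow> ('b set list \<Rightarrow> 'g) \<Rightarrow> ('a set list \<Rightarrow> 'g)" where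
  "pull_cochain X G \<W> n p c = (\<lambda>\<sigma>. if \<sigma> \<in> nerve_tuples X \<W> n then c (map p \<sigma>) else \<one>\<^bsub>G\<^esub>)"

definition cech_reps :: "'a topology \<Rightarrow> ('g,'m) monoid_scheme \<Rightarrow> nat
    \<Rightarrow> ('a set set \<times> ('a set list \<Rightarrow> 'g)) set" where
  "cech_reps X G n = {(\<U>, z). fin_open_cover X \<U> \<and> z \<in> cocycles X G \<U> n}"

definition cech_rel :: "'a topology \<Rightarrow> ('g,'m) monoid_scheme \<Rightarrow> nat
    \<Rightarrow> ('a set set \<times> ('a set list \<Rightarrow> 'g)) \<Rightarrow> ('a set set \<times> ('a set list \<Rightarrow> 'g)) \<Rightarrow> bool" where
  "cech_rel X G n a b \<longleftrightarrow> a \<in> cech_reps X G n \<and> b \<in> cech_reps X G n \<and>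
     (\<exists>\<W> p q. fin_open_cover X \<W> \<and> refine_proj \<W> (fst a) p \<and> refine_proj \<W> (fst b) q \<and>
        cmult G (pull_cochain X G \<W> n p (snd a)) (cinv G (pull_cochain X G \<W> n q (snd b)))
          \<in> coboundaries X G \<W> n)"

definition cech_class :: "'a topology \<Rightarrow> ('g,'m) monoid_scheme \<Rightarrow> nat
    \<Rightarrow> ('a set set \<times> ('a set list \<Rightarrow> 'g)) \<Rightarrow> ('a set set \<times> ('a set list \<Rightarrow> 'g)) set" where
  "cech_class X G n a = {b. cech_rel X G n a b}"

text \<open>The Cech cohomology group H^n(X;G) as the direct limit over finite open covers.\<close>
definition cech_group :: "'a topology \<Rightarrow> ('g,'m) monoid_scheme \<Rightarrow> nat
    \<Rightarrow> ('a set set \<times> ('a set list \<Rightarrow> 'g)) set monoid" where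
  "cech_group X G n = \<lparr>
     carrier = cech_class X G n ` cech_reps X G n,
     mult = (\<lambda>A B. SOME C. \<exists>a\<in>A. \<exists>b\<in>B. \<exists>\<W> p q. fin_open_cover X \<W> \<and>
              refine_proj \<W> (fst a) p \<and> refine_proj \<W> (fst b) q \<and>
              C = cech_class X G n
                    (\<W>, cmult G (pull_cochain X G \<W> n p (snd a)) (pull_cochain X G \<W> n q (snd b)))),
     one = cech_class X G n ({topspace X}, \<lambda>_. \<one>\<^bsub>G\<^esub>) \<rparr>"

definition pull_cover :: "'a topology \<Rightarrow> ('a \<Rightarrow> 'b) \<Rightarrow> 'b set set \<Rightarrow> 'a set set" where
  "pull_cover X f \<V> = (\<lambda>V. f -` V \<inter> topspace X) ` \<V>"

definition cover_section :: "'a topology \<Rightarrow> ('a \<Rightarrow> 'b) \<Rightarrow> 'b set set \<Rightarrow> 'a set \<Rightarrow> 'b set" where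
  "cover_section X f \<V> W = (SOME V. V \<in> \<V> \<and> f -` V \<inter> topspace X = W)"

definition cech_hom :: "'a topology \<Rightarrow> 'b topology \<Rightarrow> ('g,'m) monoid_scheme \<Rightarrow> nat
    \<Rightarrow> ('a \<Rightarrow> 'b) \<Rightarrow> ('b set set \<times> ('b set list \<Rightarrow> 'g)) set
    \<Rightarrow> ('a set set \<times> ('a set list \<Rightarrow> 'g)) set" where
  "cech_hom X Y G n f A = (SOME B. \<exists>a\<in>A. B = cech_class X G n
      (pull_cover X f (fst a),
       pull_cochain X G (pull_cover X f (fst a)) n (cover_section X f (fst a)) (snd a)))"

end

theory Submission
  imports Defs "HOL-Library.Poly_Mapping"
begin

text \<open>
  Every finite open cover of the product is refined by one that comes from a staircase triangulation
  of a product of coloured nerves: barycentric subdivision colours the vertices of the nerve of a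
  cover of \<open>Y\<^sub>i\<close> of order \<open>n\<^sub>i + 1\<close> by \<open>0, \<dots>, n\<^sub>i\<close>, and a vertex of the product triangulation
  is graded by the sum of its colours. The product cover is therefore balanced: its \<open>n + 1\<close> grades
  colour the vertices of each simplex of its nerve injectively. Modulo coboundaries an \<open>n\<close>-cocycle on a
  balanced cover is a product of elementary cocycles, each concentrated on one \<open>n\<close>-simplex, so some
  elementary class lies outside \<open>H\<close>. It remains to realise the elementary class of a
  simplex \<open>\<gamma>\<close> as a pullback from the spheres. The sphere \<open>S\<^sup>m\<close> has the coloured partition of
  unity given by the squares of the positive and negative parts of the coordinates, and the nerve of
  \<open>Y\<^sub>i\<close> folds onto it: a vertex goes to the vertex of the same colour with positive sign iff it
  contains a chosen point common to \<open>\<gamma>\<close>. The map \<open>\<phi>\<^sub>i\<close> whose coordinates are the signed square roots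
  of the partition functions of \<open>Y\<^sub>i\<close> realises this folding and respects the staircases, and \<open>\<gamma>\<close>
  is the only simplex that it sends to its image.\<close>


section \<open>Ordered chains\<close>

text \<open>The cohomology of the spheres is never computed, and no Kuenneth formula or
  classification of maps into spheres enters: both sides carry the same staircase construction, and
  the final comparison is an equality of cochains. The obstacle is the order of the cover. Products
  of members of covers of order \<open>n_i + 1\<close> overlap too often, and an arbitrary
  \<open>n\<close>-cochain on them need not be a cocycle. A triangulation of the product has
  dimension \<open>n\<close>, so every choice of values on its \<open>n\<close>-simplices gives a
  cocycle. This freedom breaks a class into pieces supported on single simplices, for any
  coefficients. As \<open>H\<close> is a subgroup, it cannot contain all pieces of a class outside
  \<open>H\<close>; the maps need to reach one piece only and may depend on its simplex. Colours
  serve three ends. They order the vertices as the staircases require; they orient each simplex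
  canonically, which turns Cech cochains on ordered tuples with repetitions into alternating ones
  without choices; and the folding preserves them, so it commutes with the alternation.\<close>

type_synonym 'v chain = "'v list \<Rightarrow>\<^sub>0 int"

abbreviation cone :: "'v \<Rightarrow> 'v chain \<Rightarrow> 'v chain" where
  "cone x \<equiv> frag_extend (\<lambda>s. frag_of (x # s))"

text \<open>The boundary is augmented: the empty list is the simplex of dimension \<open>-1\<close>.\<close>

primrec bd :: "'v list \<Rightarrow> 'v chain" where
  "bd [] = 0"
| "bd (x # xs) = frag_of xs - cone x (bd xs)"

lemmas frag_linear = frag_extend_add frag_extend_diff frag_extend_minus

text \<open>The augmentation makes this hold for all chains, with no correction term in dimension
  0.\<close>

lemma Bd_cone: "frag_extend bd (cone x c) = c - cone x (frag_extend bd c)"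
  using subset_UNIV[of "Poly_Mapping.keys c"]
  by (induction c rule: frag_induction) (auto simp: frag_linear)

lemma Bd_bd: "frag_extend bd (bd s) = 0"
  by (induction s) (auto simp: frag_linear Bd_cone)

lemma keys_cone: "s \<in> Poly_Mapping.keys (cone x c) \<Longrightarrow> \<exists>t\<in>Poly_Mapping.keys c. s = x # t"
  using keys_frag_extend[of "\<lambda>s. frag_of (x # s)" c] by auto

lemma keys_diffD: "s \<in> Poly_Mapping.keys (a - b) \<Longrightarrow> s \<in> Poly_Mapping.keys a \<or> s \<in> Poly_Mapping.keys b"
  using keys_diff[of a b] by auto

lemma keys_frag_extendD:
  "s \<in> Poly_Mapping.keys (frag_extend f c) \<Longrightarrow> \<exists>t\<in>Poly_Mapping.keys c. s \<in> Poly_Mapping.keys (f t)"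
  using keys_frag_extend[of f c] by auto

lemma keys_bd:
  "s \<in> Poly_Mapping.keys (bd t) \<Longrightarrow> set s \<subseteq> set t \<and> length t = Suc (length s)"
proof (induction t arbitrary: s)
  case (Cons x xs)
  then consider "s = xs" | u where "u \<in> Poly_Mapping.keys (bd xs)" "s = x # u"
    by (auto dest!: keys_diffD keys_cone)
  then show ?case
    by cases (use Cons.IH in force)+
qed simp

text \<open>Links the recursive boundary, on which the inductions run, to the alternating sum in
  \<open>cobdry\<close>.\<close>

lemma bd_eq_sum_faces:
  "bd s = (\<Sum>j<length s. frag_cmul ((-1) ^ j) (frag_of (face j s)))"
proof (induction s)
  case (Cons x xs)
  have "cone x (bd xs) = (\<Sum>j<length xs. frag_cmul ((-1) ^ j) (frag_of (x # face j xs)))"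
    by (simp add: Cons.IH frag_extend_sum frag_extend_cmul)
  then show ?case
    by (simp add: sum.lessThan_Suc_shift face_def sum_negf[symmetric] o_def del: sum.lessThan_Suc)
qed simp

lemma bd_map: "bd (map p s) = frag_extend (\<lambda>t. frag_of (map p t)) (bd s)"
proof (induction s)
  case (Cons x xs)
  have "frag_extend (\<lambda>t. frag_of (map p t)) (cone x c) = cone (p x) (frag_extend (\<lambda>t. frag_of (map p t)) c)"
    for c
    using subset_UNIV[of "Poly_Mapping.keys c"]
    by (induction c rule: frag_induction) (auto simp: frag_linear)
  with Cons show ?case by (simp add: frag_linear)
qed simp

lemma frag_extend_extend:
  "frag_extend f (frag_extend g c) = frag_extend (\<lambda>x. frag_extend f (g x)) c"
  using subset_UNIV[of "Poly_Mapping.keys c"]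
  by (induction c rule: frag_induction) (auto simp: frag_linear)

lemma frag_extend_fun_add: "frag_extend (\<lambda>x. f x + g x) c = frag_extend f c + frag_extend g c"
  using subset_UNIV[of "Poly_Mapping.keys c"]
  by (induction c rule: frag_induction) (auto simp: frag_linear)

lemma frag_extend_fun_diff: "frag_extend (\<lambda>x. f x - g x) c = frag_extend f c - frag_extend g c"
  using subset_UNIV[of "Poly_Mapping.keys c"]
  by (induction c rule: frag_induction) (auto simp: frag_linear)

text \<open>The number is fuel: it is always the length of \<open>t\<close>, which \<open>bd\<close>
  lowers by one. \<open>F\<close> is the chain map to be contracted and \<open>v t\<close> is the
  apex of the cone.\<close>

primrec cone_homotopy ::
  "('w list \<Rightarrow> 'v chain) \<Rightarrow> ('w list \<Rightarrow> 'v) \<Rightarrow> nat \<Rightarrow> 'w list \<Rightarrow> 'v chain" where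
  "cone_homotopy F v 0 t = 0"
| "cone_homotopy F v (Suc n) t = cone (v t) (F t - frag_extend (cone_homotopy F v n) (bd t))"

text \<open>The carrier of a simplex \<open>t\<close> is the full simplex on \<open>C t\<close>, whose chains are contracted by the
  cone over \<open>v t\<close>.\<close>

lemma acyclic_carrier:
  fixes F :: "'w list \<Rightarrow> 'v chain"
  assumes P: "\<And>t s. P t \<Longrightarrow> s \<in> Poly_Mapping.keys (bd t) \<Longrightarrow> P s"
    and F: "\<And>t. P t \<Longrightarrow> frag_extend bd (F t) = frag_extend F (bd t)"
    and F0: "F [] = 0"
    and FC: "\<And>t s. P t \<Longrightarrow> s \<in> Poly_Mapping.keys (F t) \<Longrightarrow> length s = length t \<and> set s \<subseteq> C t"
    and C: "\<And>t s. P t \<Longrightarrow> s \<in> Poly_Mapping.keys (bd t) \<Longrightarrow> C s \<subseteq> C t"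
    and v: "\<And>t. P t \<Longrightarrow> t \<noteq> [] \<Longrightarrow> v t \<in> C t"
  obtains D where
    "\<forall>t. P t \<longrightarrow> frag_extend bd (D t) + frag_extend D (bd t) = F t"
    "\<forall>t s. P t \<longrightarrow> s \<in> Poly_Mapping.keys (D t) \<longrightarrow> length s = Suc (length t) \<and> set s \<subseteq> C t"
proof -
  define D where "D t = cone_homotopy F v (length t) t" for t
  have D_ext: "frag_extend D (bd t) = frag_extend (cone_homotopy F v n) (bd t)"
    if "length t = Suc n" for t n
    using that by (intro frag_extend_eq) (auto simp: D_def dest!: keys_bd)
  have D_rec: "D t = cone (v t) (F t - frag_extend D (bd t))" if "t \<noteq> []" for t
    using that by (cases "length t") (auto simp: D_def D_ext simp del: bd.simps)
  have D_Nil: "D [] = 0" by (simp add: D_def)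
  have eq: "frag_extend bd (D t) + frag_extend D (bd t) = F t" if "P t" for t
    using that
  proof (induction "length t" arbitrary: t rule: less_induct)
    case less
    show ?case
    proof (cases "t = []")
      case False
      \<comment> \<open>The induction hypothesis, summed over the faces, shows that
        \<open>F t - frag_extend D (bd t)\<close> is a cycle; the cone over it then has exactly this
        cycle as boundary.\<close>
      have "frag_extend (\<lambda>s. frag_extend bd (D s) + frag_extend D (bd s)) (bd t) = frag_extend F (bd t)"
        by (intro frag_extend_eq less.hyps P[OF less.prems]) (auto dest: keys_bd)
      then have "frag_extend bd (frag_extend D (bd t)) = frag_extend F (bd t)"
        by (simp add: frag_extend_fun_add frag_extend_extend[symmetric] Bd_bd)
      then show ?thesis
        using False by (simp add: D_rec[of t] Bd_cone frag_linear F[OF less.prems])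
    qed (simp add: D_Nil F0)
  qed
  have keys: "length s = Suc (length t) \<and> set s \<subseteq> C t" if "P t" "s \<in> Poly_Mapping.keys (D t)" for t s
    using that
  proof (induction "length t" arbitrary: t s rule: less_induct)
    case less
    then have t: "t \<noteq> []" using D_Nil by auto
    then obtain u where u: "u \<in> Poly_Mapping.keys (F t - frag_extend D (bd t))" "s = v t # u"
      using less.prems D_rec by (metis keys_cone)
    then consider "u \<in> Poly_Mapping.keys (F t)"
      | r where "r \<in> Poly_Mapping.keys (bd t)" "u \<in> Poly_Mapping.keys (D r)"
      by (metis keys_diffD keys_frag_extendD)
    then show ?case
    proof cases
      case 1
      then show ?thesis using FC[OF less.prems(1)] u v[OF less.prems(1) t] by auto
    next
      case 2
      then have "length r < length t" "P r" using keys_bd P less.prems by fastforce+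
      then have "length u = Suc (length r)" "set u \<subseteq> C r" using less.hyps 2 by auto
      then show ?thesis
        using keys_bd[OF 2(1)] C[OF less.prems(1) 2(1)] u v[OF less.prems(1) t] by auto
    qed
  qed
  show thesis using that eq keys by blast
qed

section \<open>Evaluation of cochains on chains\<close>

context comm_group
begin

text \<open>The pairing of a \<open>G\<close>-valued cochain with an integral chain. Through it,
  identities of cochains are proved once for integral chains and hold for every
  \<open>G\<close>.\<close>

definition ev :: "('s \<Rightarrow> 'a) \<Rightarrow> ('s \<Rightarrow>\<^sub>0 int) \<Rightarrow> 'a" where
  "ev c x = (\<Otimes>s\<in>Poly_Mapping.keys x. c s [^] Poly_Mapping.lookup x s)"

lemma ev_superset:
  assumes "finite S" "Poly_Mapping.keys x \<subseteq> S" "\<And>s. c s \<in> carrier G"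
  shows "ev c x = (\<Otimes>s\<in>S. c s [^] Poly_Mapping.lookup x s)"
  unfolding ev_def
  by (rule finprod_mono_neutral_cong_left) (use assms in \<open>auto simp: in_keys_iff\<close>)

lemma ev_closed [simp, intro]: "(\<And>s. c s \<in> carrier G) \<Longrightarrow> ev c x \<in> carrier G"
  unfolding ev_def by (rule finprod_closed) auto

lemma ev_zero [simp]: "ev c 0 = \<one>"
  by (simp add: ev_def)

lemma ev_single:
  assumes "\<And>s. c s \<in> carrier G"
  shows "ev c (frag_cmul k (frag_of s)) = c s [^] k"
  using assms by (subst ev_superset[of "{s}"]) auto

lemma ev_frag_of [simp]: "(\<And>s. c s \<in> carrier G) \<Longrightarrow> ev c (frag_of s) = c s"
  using ev_single[of c 1 s] by simp

lemma ev_add: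
  assumes c: "\<And>s. c s \<in> carrier G"
  shows "ev c (x + y) = ev c x \<otimes> ev c y"
proof -
  let ?S = "Poly_Mapping.keys x \<union> Poly_Mapping.keys y"
  have "ev c (x + y) = (\<Otimes>s\<in>?S. c s [^] Poly_Mapping.lookup (x + y) s)"
    by (rule ev_superset) (use c keys_add[of x y] in auto)
  also have "\<dots> = (\<Otimes>s\<in>?S. c s [^] Poly_Mapping.lookup x s \<otimes> c s [^] Poly_Mapping.lookup y s)"
    by (intro finprod_cong') (auto simp: c lookup_add int_pow_mult)
  also have "\<dots> = ev c x \<otimes> ev c y"
    by (subst finprod_multf) (auto simp: c ev_superset[of ?S])
  finally show ?thesis .
qed

lemma ev_minus: "(\<And>s. c s \<in> carrier G) \<Longrightarrow> ev c (- x) = inv (ev c x)"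
  using ev_add[of c "-x" x] by (intro inv_equality[symmetric]) auto

lemma ev_diff: "(\<And>s. c s \<in> carrier G) \<Longrightarrow> ev c (x - y) = ev c x \<otimes> inv (ev c y)"
  using ev_add[of c x "-y"] ev_minus by auto

lemma ev_sum:
  assumes "\<And>s. c s \<in> carrier G" "finite J"
  shows "ev c (\<Sum>j\<in>J. f j) = (\<Otimes>j\<in>J. ev c (f j))"
  using assms(2) by (induction J) (auto simp: assms(1) ev_add)

lemma ev_frag_extend:
  assumes c: "\<And>s. c s \<in> carrier G"
  shows "ev c (frag_extend F x) = ev (\<lambda>s. ev c (F s)) x"
  using subset_UNIV[of "Poly_Mapping.keys x"]
  by (induction x rule: frag_induction) (auto simp: c ev_diff frag_linear)

lemma ev_cong:
  assumes "\<And>s. s \<in> Poly_Mapping.keys x \<Longrightarrow> c s = d s" "\<And>s. d s \<in> carrier G"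
  shows "ev c x = ev d x"
  unfolding ev_def by (rule finprod_cong') (use assms in auto)

lemma ev_cmult:
  assumes "\<And>s. c s \<in> carrier G" "\<And>s. d s \<in> carrier G"
  shows "ev (cmult G c d) x = ev c x \<otimes> ev d x"
  unfolding ev_def cmult_def using assms
  by (simp add: finprod_multf int_pow_distrib)

lemma ev_trivial: "(\<And>s. s \<in> Poly_Mapping.keys x \<Longrightarrow> c s = \<one>) \<Longrightarrow> ev c x = \<one>"
  unfolding ev_def by (intro finprod_one_eqI) auto

lemma ev_cinv:
  assumes "\<And>s. c s \<in> carrier G"
  shows "ev (cinv G c) x = inv (ev c x)"
proof -
  have "ev (cinv G c) x \<otimes> ev c x = ev (cmult G (cinv G c) c) x"
    using assms by (subst ev_cmult) (auto simp: cinv_def)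
  also have "\<dots> = \<one>"
    using assms by (intro ev_trivial) (auto simp: cmult_def cinv_def)
  finally show ?thesis
    using assms by (intro inv_equality[symmetric]) (auto simp: cinv_def)
qed

end

section \<open>Cech cochains and the Cech group\<close>

text \<open>Free of the length, and satisfied by the empty list when the space is nonempty:
  homotopies are built by recursion down to the augmentation.\<close>

definition in_nerve :: "'a topology \<Rightarrow> 'a set set \<Rightarrow> 'a set list \<Rightarrow> bool" where
  "in_nerve X \<U> s \<longleftrightarrow> set s \<subseteq> \<U> \<and> topspace X \<inter> \<Inter>(set s) \<noteq> {}"

lemma nerve_tuples_iff: "s \<in> nerve_tuples X \<U> n \<longleftrightarrow> length s = Suc n \<and> in_nerve X \<U> s"
  by (auto simp: nerve_tuples_def in_nerve_def)

lemma in_nerve_subset: "in_nerve X \<U> t \<Longrightarrow> set s \<subseteq> set t \<Longrightarrow> in_nerve X \<U> s"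
  unfolding in_nerve_def by blast

lemma in_nerve_bd: "in_nerve X \<U> t \<Longrightarrow> s \<in> Poly_Mapping.keys (bd t) \<Longrightarrow> in_nerve X \<U> s"
  by (meson in_nerve_subset keys_bd)

lemma nerve_tuples_bd:
  "t \<in> nerve_tuples X \<U> (Suc n) \<Longrightarrow> s \<in> Poly_Mapping.keys (bd t) \<Longrightarrow> s \<in> nerve_tuples X \<U> n"
  using keys_bd by (fastforce simp: nerve_tuples_iff intro: in_nerve_bd)

text \<open>A vertex map that covers \<open>f\<close>. Refinement projections are the case of the
  identity, so refinement and induced homomorphisms are handled together.\<close>

definition along ::
  "'a topology \<Rightarrow> ('a \<Rightarrow> 'b) \<Rightarrow> 'a set set \<Rightarrow> 'b set set \<Rightarrow> ('a set \<Rightarrow> 'b set) \<Rightarrow> bool" where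
  "along X f \<W> \<V> p \<longleftrightarrow> (\<forall>W\<in>\<W>. p W \<in> \<V> \<and> f ` (W \<inter> topspace X) \<subseteq> p W)"

lemma refine_proj_along: "refine_proj \<W> \<U> p \<Longrightarrow> along X (\<lambda>x. x) \<W> \<U> p"
  by (auto simp: refine_proj_def along_def)

lemma refine_proj_comp:
  "refine_proj \<W> \<V> p \<Longrightarrow> refine_proj \<V> \<U> q \<Longrightarrow> refine_proj \<W> \<U> (q \<circ> p)"
  by (fastforce simp: refine_proj_def)

lemma along_comp:
  assumes "along X f \<W> \<V> p" "along Y g \<V> \<U> q" "f \<in> topspace X \<rightarrow> topspace Y"
  shows "along X (\<lambda>x. g (f x)) \<W> \<U> (q \<circ> p)"
  using assms unfolding along_def by (fastforce simp: image_subset_iff)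

lemma in_nerve_map:
  assumes "along X f \<W> \<V> p" "f \<in> topspace X \<rightarrow> topspace Y" "in_nerve X \<W> s"
  shows "in_nerve Y \<V> (map p s)"
proof -
  from assms(3) obtain x where "x \<in> topspace X" "\<forall>W\<in>set s. x \<in> W" "set s \<subseteq> \<W>"
    by (auto simp: in_nerve_def)
  then have "f x \<in> topspace Y \<inter> \<Inter>(set (map p s))" "set (map p s) \<subseteq> \<V>"
    using assms(1,2) unfolding along_def by (auto simp: image_subset_iff Pi_iff)
  then show ?thesis unfolding in_nerve_def by blast
qed

lemma nerve_tuples_map:
  assumes "along X f \<W> \<V> p" "f \<in> topspace X \<rightarrow> topspace Y" "s \<in> nerve_tuples X \<W> n"
  shows "map p s \<in> nerve_tuples Y \<V> n"
  using in_nerve_map[OF assms(1,2)] assms(3) by (auto simp: nerve_tuples_iff)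

lemma fin_open_cover_pull:
  assumes "continuous_map X Y f" "fin_open_cover Y \<V>"
  shows "fin_open_cover X (pull_cover X f \<V>)"
proof -
  have "openin X (f -` V \<inter> topspace X)" if "V \<in> \<V>" for V
    using openin_continuous_map_preimage[OF assms(1), of V] that assms(2)
    by (simp add: fin_open_cover_def vimage_def Int_def conj_commute)
  moreover have "x \<in> \<Union> (pull_cover X f \<V>)" if "x \<in> topspace X" for x
  proof -
    have "f x \<in> \<Union>\<V>"
      using assms that by (auto simp: fin_open_cover_def continuous_map_def)
    then show ?thesis using that by (auto simp: pull_cover_def)
  qed
  then have "\<Union> (pull_cover X f \<V>) = topspace X"
    by (auto simp: pull_cover_def)
  ultimately show ?thesis
    using assms(2) by (auto simp: fin_open_cover_def pull_cover_def)
qed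

lemma along_cover_section: "along X f (pull_cover X f \<V>) \<V> (cover_section X f \<V>)"
proof -
  have "cover_section X f \<V> W \<in> \<V> \<and> f -` cover_section X f \<V> W \<inter> topspace X = W"
    if "W \<in> pull_cover X f \<V>" for W
    unfolding cover_section_def by (rule someI_ex) (use that in \<open>auto simp: pull_cover_def\<close>)
  then show ?thesis unfolding along_def by blast
qed

lemma common_refinement:
  assumes "fin_open_cover X \<U>" "fin_open_cover X \<V>"
  obtains \<W> p q where "fin_open_cover X \<W>" "refine_proj \<W> \<U> p" "refine_proj \<W> \<V> q"
proof
  let ?W = "(\<lambda>(U, V). U \<inter> V) ` (\<U> \<times> \<V>)"
  show "fin_open_cover X ?W"
    using assms unfolding fin_open_cover_def by (auto 0 3 simp: openin_Int)
  show "refine_proj ?W \<U> (\<lambda>W. SOME U. U \<in> \<U> \<and> W \<subseteq> U)"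
    unfolding refine_proj_def by (rule ballI, rule someI_ex) auto
  show "refine_proj ?W \<V> (\<lambda>W. SOME U. U \<in> \<V> \<and> W \<subseteq> U)"
    unfolding refine_proj_def by (rule ballI, rule someI_ex) auto
qed

context comm_group
begin

lemma mult_inv_eqD:
  assumes "x \<otimes> inv y = e" "x \<in> carrier G" "y \<in> carrier G"
  shows "x = e \<otimes> y"
  unfolding assms(1)[symmetric] using assms(2,3) by (simp add: m_assoc)

lemma cochains_closed: "c \<in> cochains X G \<U> n \<Longrightarrow> c s \<in> carrier G"
  unfolding cochains_def by (cases "s \<in> nerve_tuples X \<U> n") auto

lemma cobdry_eq_ev:
  assumes "\<And>s. c s \<in> carrier G"
  shows "cobdry X G \<U> n c \<sigma> = (if \<sigma> \<in> nerve_tuples X \<U> (Suc n) then ev c (bd \<sigma>) else \<one>)"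
proof -
  have "ev c (bd \<sigma>) = (\<Otimes>j\<in>{..Suc n}. c (face j \<sigma>) [^] ((-1::int) ^ j))"
    if "\<sigma> \<in> nerve_tuples X \<U> (Suc n)"
  proof -
    have "{..<length \<sigma>} = {..Suc n}" using that by (auto simp: nerve_tuples_iff)
    then show ?thesis
      unfolding bd_eq_sum_faces
      using assms by (simp add: ev_sum ev_single del: sum.atMost_Suc finprod_Suc)
  qed
  then show ?thesis unfolding cobdry_def by simp
qed

lemma cocycles_iff:
  "z \<in> cocycles X G \<U> n \<longleftrightarrow>
    z \<in> cochains X G \<U> n \<and> (\<forall>\<sigma>\<in>nerve_tuples X \<U> (Suc n). ev z (bd \<sigma>) = \<one>)"
proof (cases "z \<in> cochains X G \<U> n")
  case True
  then show ?thesis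
    unfolding cocycles_def fun_eq_iff using cobdry_eq_ev[OF cochains_closed[OF True], of X \<U> n] by auto
qed (simp add: cocycles_def)

lemma coboundaryI:
  assumes c: "c \<in> cochains X G \<U> (Suc n)" and b: "\<And>s. b s \<in> carrier G"
    and eq: "\<And>\<sigma>. \<sigma> \<in> nerve_tuples X \<U> (Suc n) \<Longrightarrow> c \<sigma> = ev b (bd \<sigma>)"
  shows "c \<in> coboundaries X G \<U> (Suc n)"
proof -
  \<comment> \<open>Cochains have to be trivial off the nerve. Truncating \<open>b\<close> changes
    no value on \<open>bd \<sigma>\<close>, because the faces of a simplex of the nerve belong to
    the nerve.\<close>
  define b' where "b' s = (if s \<in> nerve_tuples X \<U> n then b s else \<one>)" for s
  have b': "b' \<in> cochains X G \<U> n" using b by (auto simp: b'_def cochains_def)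
  have "c \<sigma> = cobdry X G \<U> n b' \<sigma>" for \<sigma>
  proof (cases "\<sigma> \<in> nerve_tuples X \<U> (Suc n)")
    case True
    have "ev b' (bd \<sigma>) = ev b (bd \<sigma>)"
      by (rule ev_cong) (use True b in \<open>auto simp: b'_def dest: nerve_tuples_bd\<close>)
    then show ?thesis using True eq b' by (simp add: cobdry_eq_ev cochains_closed)
  next
    case False
    then show ?thesis using c by (auto simp: cobdry_def cochains_def)
  qed
  then have "c = cobdry X G \<U> n b'" by auto
  then show ?thesis unfolding coboundaries_def using b' by simp
qed

lemma coboundaryE:
  assumes "c \<in> coboundaries X G \<U> (Suc n)"
  obtains b where "b \<in> cochains X G \<U> n" "c \<in> cochains X G \<U> (Suc n)"
    "\<And>\<sigma>. \<sigma> \<in> nerve_tuples X \<U> (Suc n) \<Longrightarrow> c \<sigma> = ev b (bd \<sigma>)"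
proof -
  from assms obtain b where b: "b \<in> cochains X G \<U> n" "c = cobdry X G \<U> n b"
    by (auto simp: coboundaries_def)
  have eq: "c \<sigma> = (if \<sigma> \<in> nerve_tuples X \<U> (Suc n) then ev b (bd \<sigma>) else \<one>)" for \<sigma>
    using b by (simp add: cobdry_eq_ev cochains_closed)
  have "c \<in> cochains X G \<U> (Suc n)"
    using b(1) by (auto simp: cochains_def[of X G \<U> "Suc n"] eq cochains_closed)
  then show thesis using that b eq by auto
qed

lemma cmult_cochains:
  "c \<in> cochains X G \<U> n \<Longrightarrow> d \<in> cochains X G \<U> n \<Longrightarrow> cmult G c d \<in> cochains X G \<U> n"
  by (auto simp: cochains_def cmult_def)

lemma cinv_cochains: "c \<in> cochains X G \<U> n \<Longrightarrow> cinv G c \<in> cochains X G \<U> n"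
  by (auto simp: cochains_def cinv_def)

lemma cmult_cocycles:
  assumes "c \<in> cocycles X G \<U> n" "d \<in> cocycles X G \<U> n"
  shows "cmult G c d \<in> cocycles X G \<U> n"
  using assms by (auto simp: cocycles_iff cmult_cochains ev_cmult cochains_closed)

lemma one_cocycle: "(\<lambda>_. \<one>) \<in> cocycles X G \<U> n"
  by (auto simp: cocycles_iff cochains_def ev_trivial)

section \<open>Cohomologous cochains on a fixed cover\<close>

definition cohomologous ::
  "'x topology \<Rightarrow> 'x set set \<Rightarrow> nat \<Rightarrow> ('x set list \<Rightarrow> 'a) \<Rightarrow> ('x set list \<Rightarrow> 'a) \<Rightarrow> bool" where
  "cohomologous X \<U> n c d \<longleftrightarrow> c \<in> cochains X G \<U> n \<and> d \<in> cochains X G \<U> n \<and>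
     cmult G c (cinv G d) \<in> coboundaries X G \<U> n"

text \<open>The degree is a successor from here on: degree 0 has its own clause in
  \<open>coboundaries\<close>, and the degree of the theorem is positive.\<close>

lemma cohomologous_iff:
  "cohomologous X \<U> (Suc n) c d \<longleftrightarrow> c \<in> cochains X G \<U> (Suc n) \<and> d \<in> cochains X G \<U> (Suc n) \<and>
     (\<exists>b\<in>cochains X G \<U> n. \<forall>\<sigma>\<in>nerve_tuples X \<U> (Suc n). c \<sigma> = ev b (bd \<sigma>) \<otimes> d \<sigma>)"
  (is "?L \<longleftrightarrow> ?R")
proof
  assume L: ?L
  then obtain b where b: "b \<in> cochains X G \<U> n"
    "\<And>\<sigma>. \<sigma> \<in> nerve_tuples X \<U> (Suc n) \<Longrightarrow> cmult G c (cinv G d) \<sigma> = ev b (bd \<sigma>)"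
    unfolding cohomologous_def by (auto elim: coboundaryE)
  have "c \<sigma> = ev b (bd \<sigma>) \<otimes> d \<sigma>" if "\<sigma> \<in> nerve_tuples X \<U> (Suc n)" for \<sigma>
  proof -
    have "c \<sigma> \<otimes> inv d \<sigma> = ev b (bd \<sigma>)" "c \<sigma> \<in> carrier G" "d \<sigma> \<in> carrier G"
      using b(2)[OF that] L by (auto simp: cohomologous_def cmult_def cinv_def cochains_closed)
    then show ?thesis by (rule mult_inv_eqD)
  qed
  then show ?R using L b(1) by (auto simp: cohomologous_def)
next
  assume R: ?R
  then obtain b where b: "b \<in> cochains X G \<U> n"
    "\<And>\<sigma>. \<sigma> \<in> nerve_tuples X \<U> (Suc n) \<Longrightarrow> c \<sigma> = ev b (bd \<sigma>) \<otimes> d \<sigma>" by auto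
  have "cmult G c (cinv G d) \<in> coboundaries X G \<U> (Suc n)"
  proof (rule coboundaryI)
    show "cmult G c (cinv G d) \<in> cochains X G \<U> (Suc n)" using R by (intro cmult_cochains cinv_cochains) auto
    show "cmult G c (cinv G d) \<sigma> = ev b (bd \<sigma>)" if "\<sigma> \<in> nerve_tuples X \<U> (Suc n)" for \<sigma>
      using R b that by (auto simp: cmult_def cinv_def cochains_closed m_assoc)
  qed (use b in \<open>auto intro: cochains_closed\<close>)
  with R show ?L by (auto simp: cohomologous_def)
qed

lemma cohomologous_refl:
  assumes "c \<in> cochains X G \<U> (Suc n)"
  shows "cohomologous X \<U> (Suc n) c c"
proof -
  have "(\<lambda>_. \<one>) \<in> cochains X G \<U> n" by (simp add: cochains_def)
  moreover have "c \<sigma> = ev (\<lambda>_. \<one>) (bd \<sigma>) \<otimes> c \<sigma>" for \<sigma>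
    using cochains_closed[OF assms] by (simp add: ev_trivial)
  ultimately show ?thesis unfolding cohomologous_iff using assms by blast
qed

lemma cohomologous_sym:
  assumes "cohomologous X \<U> (Suc n) c d"
  shows "cohomologous X \<U> (Suc n) d c"
proof -
  from assms obtain b where b: "c \<in> cochains X G \<U> (Suc n)" "d \<in> cochains X G \<U> (Suc n)"
    "b \<in> cochains X G \<U> n" "\<forall>\<sigma>\<in>nerve_tuples X \<U> (Suc n). c \<sigma> = ev b (bd \<sigma>) \<otimes> d \<sigma>"
    unfolding cohomologous_iff by auto
  have "d \<sigma> = ev (cinv G b) (bd \<sigma>) \<otimes> c \<sigma>" if "\<sigma> \<in> nerve_tuples X \<U> (Suc n)" for \<sigma>
    using b that by (simp add: ev_cinv cochains_closed flip: m_assoc)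
  then show ?thesis unfolding cohomologous_iff using b cinv_cochains by blast
qed

lemma cohomologous_trans:
  assumes "cohomologous X \<U> (Suc n) c d" "cohomologous X \<U> (Suc n) d e"
  shows "cohomologous X \<U> (Suc n) c e"
proof -
  from assms(1) obtain b where b: "c \<in> cochains X G \<U> (Suc n)" "d \<in> cochains X G \<U> (Suc n)"
    "b \<in> cochains X G \<U> n" "\<forall>\<sigma>\<in>nerve_tuples X \<U> (Suc n). c \<sigma> = ev b (bd \<sigma>) \<otimes> d \<sigma>"
    unfolding cohomologous_iff by auto
  from assms(2) obtain b' where b': "e \<in> cochains X G \<U> (Suc n)"
    "b' \<in> cochains X G \<U> n" "\<forall>\<sigma>\<in>nerve_tuples X \<U> (Suc n). d \<sigma> = ev b' (bd \<sigma>) \<otimes> e \<sigma>"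
    unfolding cohomologous_iff by auto
  have "c \<sigma> = ev (cmult G b b') (bd \<sigma>) \<otimes> e \<sigma>" if "\<sigma> \<in> nerve_tuples X \<U> (Suc n)" for \<sigma>
    using b b' that by (simp add: ev_cmult cochains_closed m_assoc)
  then show ?thesis unfolding cohomologous_iff using b b' cmult_cochains by blast
qed

lemma cohomologous_cmult:
  assumes "cohomologous X \<U> (Suc n) c d" "cohomologous X \<U> (Suc n) c' d'"
  shows "cohomologous X \<U> (Suc n) (cmult G c c') (cmult G d d')"
proof -
  from assms(1) obtain b where b: "c \<in> cochains X G \<U> (Suc n)" "d \<in> cochains X G \<U> (Suc n)"
    "b \<in> cochains X G \<U> n" "\<forall>\<sigma>\<in>nerve_tuples X \<U> (Suc n). c \<sigma> = ev b (bd \<sigma>) \<otimes> d \<sigma>"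
    unfolding cohomologous_iff by auto
  from assms(2) obtain b' where b': "c' \<in> cochains X G \<U> (Suc n)" "d' \<in> cochains X G \<U> (Suc n)"
    "b' \<in> cochains X G \<U> n" "\<forall>\<sigma>\<in>nerve_tuples X \<U> (Suc n). c' \<sigma> = ev b' (bd \<sigma>) \<otimes> d' \<sigma>"
    unfolding cohomologous_iff by auto
  have "cmult G c c' \<sigma> = ev (cmult G b b') (bd \<sigma>) \<otimes> cmult G d d' \<sigma>"
    if "\<sigma> \<in> nerve_tuples X \<U> (Suc n)" for \<sigma>
  proof -
    have "(p \<otimes> q) \<otimes> (r \<otimes> s) = (p \<otimes> r) \<otimes> (q \<otimes> s)"
      if "p \<in> carrier G" "q \<in> carrier G" "r \<in> carrier G" "s \<in> carrier G" for p q r s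
      using that by (simp add: m_ac)
    then show ?thesis
      using b b' that ev_cmult[of b b'] by (simp add: cochains_closed cmult_def[of G d] cmult_def[of G c])
  qed
  then show ?thesis
    unfolding cohomologous_iff using b b' cmult_cochains by blast
qed

section \<open>Pulling back along vertex maps; contiguity\<close>

lemma pull_cochain_cochains:
  assumes "\<And>s. c s \<in> carrier G"
  shows "pull_cochain X G \<W> n p c \<in> cochains X G \<W> n"
  using assms by (auto simp: pull_cochain_def cochains_def)

lemma pull_cochain_comp:
  assumes "along X f \<W> \<V> p" "f \<in> topspace X \<rightarrow> topspace Y"
  shows "pull_cochain X G \<W> n p (pull_cochain Y G \<V> n q c) = pull_cochain X G \<W> n (q \<circ> p) c"
  using nerve_tuples_map[OF assms] by (auto simp: pull_cochain_def fun_eq_iff)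

lemma pull_cochain_refine:
  assumes "refine_proj \<W> \<V> p"
  shows "pull_cochain X G \<W> n p (pull_cochain X G \<V> n q c) = pull_cochain X G \<W> n (q \<circ> p) c"
  by (rule pull_cochain_comp[OF refine_proj_along[OF assms]]) simp

lemma pull_cochain_cmult:
  "pull_cochain X G \<W> n p (cmult G c d) =
    cmult G (pull_cochain X G \<W> n p c) (pull_cochain X G \<W> n p d)"
  by (auto simp: pull_cochain_def cmult_def)

lemma ev_pull_bd:
  assumes "\<And>s. c s \<in> carrier G" "\<sigma> \<in> nerve_tuples X \<W> (Suc n)"
  shows "ev (pull_cochain X G \<W> n p c) (bd \<sigma>) = ev c (bd (map p \<sigma>))"
proof -
  have "ev (pull_cochain X G \<W> n p c) (bd \<sigma>) = ev (\<lambda>s. c (map p s)) (bd \<sigma>)"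
    by (rule ev_cong) (use assms in \<open>auto simp: pull_cochain_def dest: nerve_tuples_bd\<close>)
  also have "\<dots> = ev c (bd (map p \<sigma>))"
    unfolding bd_map using assms by (simp add: ev_frag_extend)
  finally show ?thesis .
qed

lemma pull_cocycle:
  assumes "along X f \<W> \<V> p" "f \<in> topspace X \<rightarrow> topspace Y" "z \<in> cocycles Y G \<V> n"
  shows "pull_cochain X G \<W> n p z \<in> cocycles X G \<W> n"
proof -
  have z: "\<And>s. z s \<in> carrier G" using assms(3) by (auto simp: cocycles_iff cochains_closed)
  show ?thesis
    using assms(3) nerve_tuples_map[OF assms(1,2)]
    by (auto simp: cocycles_iff pull_cochain_cochains z ev_pull_bd)
qed

lemma pull_cohomologous:
  assumes "along X f \<W> \<V> p" "f \<in> topspace X \<rightarrow> topspace Y" "cohomologous Y \<V> (Suc n) c d"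
  shows "cohomologous X \<W> (Suc n) (pull_cochain X G \<W> (Suc n) p c) (pull_cochain X G \<W> (Suc n) p d)"
proof -
  from assms(3) obtain b where b: "c \<in> cochains Y G \<V> (Suc n)" "d \<in> cochains Y G \<V> (Suc n)"
    "b \<in> cochains Y G \<V> n" "\<forall>\<sigma>\<in>nerve_tuples Y \<V> (Suc n). c \<sigma> = ev b (bd \<sigma>) \<otimes> d \<sigma>"
    unfolding cohomologous_iff by auto
  have "pull_cochain X G \<W> n p b \<in> cochains X G \<W> n"
    using b by (simp add: pull_cochain_cochains cochains_closed)
  moreover have "pull_cochain X G \<W> (Suc n) p c \<sigma> =
      ev (pull_cochain X G \<W> n p b) (bd \<sigma>) \<otimes> pull_cochain X G \<W> (Suc n) p d \<sigma>"
    if "\<sigma> \<in> nerve_tuples X \<W> (Suc n)" for \<sigma>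
    using that b nerve_tuples_map[OF assms(1,2) that]
    by (subst ev_pull_bd) (auto simp: pull_cochain_def cochains_closed)
  ultimately show ?thesis
    unfolding cohomologous_iff using b by (auto simp: pull_cochain_cochains cochains_closed)
qed

text \<open>The simplex on all members of \<open>\<V>\<close> that contain the image of the
  intersection of \<open>t\<close> is an acyclic carrier for \<open>F\<close>, so \<open>F\<close>
  is null-homotopic and \<open>z\<close> composed with it is a coboundary. It is meant for
  differences of chain maps: of two vertex maps, and of the identity and the alternation.\<close>

lemma homotopy_coboundary:
  fixes F :: "'x set list \<Rightarrow> 'y set chain"
  assumes z: "z \<in> cocycles Y G \<V> (Suc n)"
    and p: "along X f \<W> \<V> p" and f: "f \<in> topspace X \<rightarrow> topspace Y"
    and F: "\<And>t. in_nerve X \<W> t \<Longrightarrow> frag_extend bd (F t) = frag_extend F (bd t)"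
    and F0: "F [] = 0"
    and FC: "\<And>t s. in_nerve X \<W> t \<Longrightarrow> s \<in> Poly_Mapping.keys (F t) \<Longrightarrow>
      length s = length t \<and> set s \<subseteq> {V\<in>\<V>. f ` (topspace X \<inter> \<Inter>(set t)) \<subseteq> V}"
  shows "\<exists>b\<in>cochains X G \<W> n. \<forall>\<sigma>\<in>nerve_tuples X \<W> (Suc n). ev z (F \<sigma>) = ev b (bd \<sigma>)"
proof -
  let ?C = "\<lambda>t. {V\<in>\<V>. f ` (topspace X \<inter> \<Inter>(set t)) \<subseteq> V}"
  have zc: "\<And>s. z s \<in> carrier G" using z by (auto simp: cocycles_iff cochains_closed)
  have C: "?C s \<subseteq> ?C t" if "s \<in> Poly_Mapping.keys (bd t)" for s t
    using keys_bd[OF that] by (auto simp: image_subset_iff)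
  have v: "p (hd t) \<in> ?C t" if "in_nerve X \<W> t" "t \<noteq> []" for t
  proof -
    have "hd t \<in> set t" using that(2) by simp
    then show ?thesis using that p unfolding in_nerve_def along_def by blast
  qed
  obtain D where D: "\<forall>t. in_nerve X \<W> t \<longrightarrow> frag_extend bd (D t) + frag_extend D (bd t) = F t"
    and DC: "\<forall>t s. in_nerve X \<W> t \<longrightarrow> s \<in> Poly_Mapping.keys (D t) \<longrightarrow>
      length s = Suc (length t) \<and> set s \<subseteq> ?C t"
    by (rule acyclic_carrier[of "in_nerve X \<W>" F ?C "\<lambda>t. p (hd t)", OF in_nerve_bd F F0 FC C v])
  define b where "b t = (if t \<in> nerve_tuples X \<W> n then ev z (D t) else \<one>)" for t
  have b: "b \<in> cochains X G \<W> n" by (auto simp: b_def cochains_def zc)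
  have "ev z (F \<sigma>) = ev b (bd \<sigma>)" if \<sigma>: "\<sigma> \<in> nerve_tuples X \<W> (Suc n)" for \<sigma>
  proof -
    have n: "in_nerve X \<W> \<sigma>" using \<sigma> by (simp add: nerve_tuples_iff)
    have "ev z (frag_extend bd (D \<sigma>)) = \<one>"
    proof (subst ev_frag_extend[OF zc], rule ev_trivial)
      fix s assume "s \<in> Poly_Mapping.keys (D \<sigma>)"
      then have s: "length s = Suc (length \<sigma>)" "set s \<subseteq> ?C \<sigma>" using DC n by auto
      \<comment> \<open>The image of a single point of the intersection of \<open>\<sigma>\<close>
        lies in all vertices of \<open>s\<close>, so \<open>s\<close> is a simplex of the nerve,
        where the cocycle condition applies.\<close>
      obtain x where x: "x \<in> topspace X \<inter> \<Inter>(set \<sigma>)" using n by (auto simp: in_nerve_def)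
      then have "f x \<in> topspace Y \<inter> \<Inter>(set s)" using s f by blast
      then have "s \<in> nerve_tuples Y \<V> (Suc (Suc n))"
        using s \<sigma> by (auto simp: nerve_tuples_iff in_nerve_def)
      then show "ev z (bd s) = \<one>" using z by (simp add: cocycles_iff)
    qed
    moreover have "ev z (frag_extend D (bd \<sigma>)) = ev b (bd \<sigma>)"
      unfolding ev_frag_extend[OF zc]
      by (rule ev_cong) (use \<sigma> b in \<open>auto simp: b_def zc dest: nerve_tuples_bd\<close>)
    ultimately show ?thesis
      using D n zc b by (metis cochains_closed ev_add ev_closed l_one)
  qed
  then show ?thesis using b by blast
qed

text \<open>Both images of a simplex lie in the carrier of \<open>homotopy_coboundary\<close>, hence
  so does their difference. Every later independence of the choice of projections comes from
  here.\<close>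

lemma contiguous_cohomologous:
  assumes z: "z \<in> cocycles Y G \<V> (Suc n)"
    and p: "along X f \<W> \<V> p" and q: "along X f \<W> \<V> q" and f: "f \<in> topspace X \<rightarrow> topspace Y"
  shows "cohomologous X \<W> (Suc n) (pull_cochain X G \<W> (Suc n) p z) (pull_cochain X G \<W> (Suc n) q z)"
proof -
  define F where "F t = frag_of (map p t) - frag_of (map q t)" for t
  have zc: "\<And>s. z s \<in> carrier G" using z by (auto simp: cocycles_iff cochains_closed)
  have "\<exists>b\<in>cochains X G \<W> n. \<forall>\<sigma>\<in>nerve_tuples X \<W> (Suc n). ev z (F \<sigma>) = ev b (bd \<sigma>)"
  proof (rule homotopy_coboundary[OF z p f])
    show "frag_extend bd (F t) = frag_extend F (bd t)" for t
      unfolding F_def frag_extend_fun_diff by (simp add: frag_linear bd_map)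
    show "F [] = 0" by (simp add: F_def)
    show "length s = length t \<and> set s \<subseteq> {V\<in>\<V>. f ` (topspace X \<inter> \<Inter>(set t)) \<subseteq> V}"
      if "in_nerve X \<W> t" "s \<in> Poly_Mapping.keys (F t)" for s t
    proof -
      have "p W \<in> \<V> \<and> f ` (topspace X \<inter> \<Inter>(set t)) \<subseteq> p W"
           "q W \<in> \<V> \<and> f ` (topspace X \<inter> \<Inter>(set t)) \<subseteq> q W" if "W \<in> set t" for W
        using \<open>in_nerve X \<W> t\<close> that p q unfolding in_nerve_def along_def by blast+
      moreover have "s = map p t \<or> s = map q t"
        using that(2) by (auto simp: F_def dest!: keys_diffD)
      ultimately show ?thesis by (auto simp: image_subset_iff)
    qed
  qed
  then obtain b where b: "b \<in> cochains X G \<W> n"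
    "\<And>\<sigma>. \<sigma> \<in> nerve_tuples X \<W> (Suc n) \<Longrightarrow> z (map p \<sigma>) \<otimes> inv z (map q \<sigma>) = ev b (bd \<sigma>)"
    by (auto simp: F_def ev_diff zc)
  have "z (map p \<sigma>) = ev b (bd \<sigma>) \<otimes> z (map q \<sigma>)" if "\<sigma> \<in> nerve_tuples X \<W> (Suc n)" for \<sigma>
    by (rule mult_inv_eqD) (use that zc b(2) in auto)
  then show ?thesis
    unfolding cohomologous_iff
    using b(1) pull_cochain_cochains[OF zc, of X \<W> "Suc n"] by (fastforce simp: pull_cochain_def)
qed

section \<open>The direct limit over covers\<close>

lemma cech_reps_iff:
  "a \<in> cech_reps X G n \<longleftrightarrow> fin_open_cover X (fst a) \<and> snd a \<in> cocycles X G (fst a) n"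
  by (cases a) (simp add: cech_reps_def)

lemma cech_rel_iff:
  "cech_rel X G n a b \<longleftrightarrow> a \<in> cech_reps X G n \<and> b \<in> cech_reps X G n \<and>
    (\<exists>\<W> p q. fin_open_cover X \<W> \<and> refine_proj \<W> (fst a) p \<and> refine_proj \<W> (fst b) q \<and>
      cohomologous X \<W> n (pull_cochain X G \<W> n p (snd a)) (pull_cochain X G \<W> n q (snd b)))"
proof -
  have "pull_cochain X G \<W> n p (snd a) \<in> cochains X G \<W> n" if "a \<in> cech_reps X G n" for \<W> p a
    using that by (auto simp: cech_reps_iff cocycles_iff intro!: pull_cochain_cochains cochains_closed)
  then show ?thesis unfolding cech_rel_def cohomologous_def by blast
qed

lemma pull_reps:
  assumes "a \<in> cech_reps Y G n" "continuous_map X Y f" "fin_open_cover X \<W>" "along X f \<W> (fst a) p"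
  shows "(\<W>, pull_cochain X G \<W> n p (snd a)) \<in> cech_reps X G n"
  using assms pull_cocycle[OF assms(4)] by (auto simp: cech_reps_iff continuous_map_def)

text \<open>Contiguity turns the existential quantifiers in \<open>cech_rel\<close> into universal
  ones: beyond some cover, any vertex maps whatsoever give cohomologous cocycles. Proofs about the
  limit then reduce to finding common refinements.\<close>

lemma cech_rel_eventually:
  assumes rel: "cech_rel Y G (Suc n) a b" and f: "continuous_map X Y f"
  obtains \<W>\<^sub>1 where "fin_open_cover X \<W>\<^sub>1"
    "\<forall>\<W> r p q. refine_proj \<W> \<W>\<^sub>1 r \<longrightarrow> along X f \<W> (fst a) p \<longrightarrow> along X f \<W> (fst b) q \<longrightarrow>
      cohomologous X \<W> (Suc n) (pull_cochain X G \<W> (Suc n) p (snd a)) (pull_cochain X G \<W> (Suc n) q (snd b))"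
proof -
  from rel obtain \<W>\<^sub>0 p0 q0 where a: "snd a \<in> cocycles Y G (fst a) (Suc n)"
    and b: "snd b \<in> cocycles Y G (fst b) (Suc n)"
    and W0: "fin_open_cover Y \<W>\<^sub>0" "refine_proj \<W>\<^sub>0 (fst a) p0" "refine_proj \<W>\<^sub>0 (fst b) q0"
      "cohomologous Y \<W>\<^sub>0 (Suc n) (pull_cochain Y G \<W>\<^sub>0 (Suc n) p0 (snd a)) (pull_cochain Y G \<W>\<^sub>0 (Suc n) q0 (snd b))"
    by (auto simp: cech_rel_iff cech_reps_iff)
  have fY: "f \<in> topspace X \<rightarrow> topspace Y" using f by (simp add: continuous_map_def)
  let ?W1 = "pull_cover X f \<W>\<^sub>0" and ?s = "cover_section X f \<W>\<^sub>0"
  show thesis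
  proof
    show "fin_open_cover X ?W1" using f W0(1) by (rule fin_open_cover_pull)
    show "\<forall>\<W> r p q. refine_proj \<W> ?W1 r \<longrightarrow> along X f \<W> (fst a) p \<longrightarrow> along X f \<W> (fst b) q \<longrightarrow>
      cohomologous X \<W> (Suc n) (pull_cochain X G \<W> (Suc n) p (snd a)) (pull_cochain X G \<W> (Suc n) q (snd b))"
    proof (intro allI impI)
      fix \<W> r p q
      assume r: "refine_proj \<W> ?W1 r" and p: "along X f \<W> (fst a) p" and q: "along X f \<W> (fst b) q"
      have s: "along X f \<W> \<W>\<^sub>0 (?s \<circ> r)"
        using along_comp[OF refine_proj_along[OF r] along_cover_section] by simp
      have "along X f \<W> (fst a) (p0 \<circ> (?s \<circ> r))" "along X f \<W> (fst b) (q0 \<circ> (?s \<circ> r))"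
        using along_comp[OF s refine_proj_along[OF W0(2)] fY] along_comp[OF s refine_proj_along[OF W0(3)] fY]
        by simp_all
      \<comment> \<open>\<open>p\<close> and \<open>q\<close> are compared with the vertex maps that
        factor through \<open>\<W>\<^sub>0\<close>, where the relation is known; transitivity closes
        the chain.\<close>
      note c = contiguous_cohomologous[OF a p this(1) fY] contiguous_cohomologous[OF b this(2) q fY]
      show "cohomologous X \<W> (Suc n) (pull_cochain X G \<W> (Suc n) p (snd a)) (pull_cochain X G \<W> (Suc n) q (snd b))"
        using c pull_cohomologous[OF s fY W0(4)] unfolding pull_cochain_comp[OF s fY]
        by (meson cohomologous_trans)
    qed
  qed
qed

text \<open>With \<open>f\<close> the identity this gives invariance under refinement, and for
  general \<open>f\<close> that the induced homomorphism is well defined.\<close>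

lemma cech_rel_pull:
  assumes rel: "cech_rel Y G (Suc n) a b" and f: "continuous_map X Y f"
    and U: "fin_open_cover X \<U>" "along X f \<U> (fst a) p"
    and U': "fin_open_cover X \<U>'" "along X f \<U>' (fst b) p'"
  shows "cech_rel X G (Suc n) (\<U>, pull_cochain X G \<U> (Suc n) p (snd a))
    (\<U>', pull_cochain X G \<U>' (Suc n) p' (snd b))"
proof -
  obtain \<W>\<^sub>1 where W1: "fin_open_cover X \<W>\<^sub>1"
    "\<forall>\<W> r p q. refine_proj \<W> \<W>\<^sub>1 r \<longrightarrow> along X f \<W> (fst a) p \<longrightarrow> along X f \<W> (fst b) q \<longrightarrow>
      cohomologous X \<W> (Suc n) (pull_cochain X G \<W> (Suc n) p (snd a)) (pull_cochain X G \<W> (Suc n) q (snd b))"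
    by (rule cech_rel_eventually[OF rel f])
  obtain \<W>\<^sub>2 r s where W2: "fin_open_cover X \<W>\<^sub>2" "refine_proj \<W>\<^sub>2 \<U> r" "refine_proj \<W>\<^sub>2 \<U>' s"
    by (rule common_refinement[OF U(1) U'(1)])
  obtain \<W> u v where W: "fin_open_cover X \<W>" "refine_proj \<W> \<W>\<^sub>1 u" "refine_proj \<W> \<W>\<^sub>2 v"
    by (rule common_refinement[OF W1(1) W2(1)])
  have rv: "refine_proj \<W> \<U> (r \<circ> v)" "refine_proj \<W> \<U>' (s \<circ> v)"
    using refine_proj_comp[OF W(3) W2(2)] refine_proj_comp[OF W(3) W2(3)] by auto
  have al: "along X f \<W> (fst a) (p \<circ> (r \<circ> v))" "along X f \<W> (fst b) (p' \<circ> (s \<circ> v))"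
    using along_comp[OF refine_proj_along[OF rv(1)] U(2)] along_comp[OF refine_proj_along[OF rv(2)] U'(2)]
    by simp_all
  have "cohomologous X \<W> (Suc n)
      (pull_cochain X G \<W> (Suc n) (r \<circ> v) (pull_cochain X G \<U> (Suc n) p (snd a)))
      (pull_cochain X G \<W> (Suc n) (s \<circ> v) (pull_cochain X G \<U>' (Suc n) p' (snd b)))"
    using W1(2)[rule_format, OF W(2) al]
    unfolding pull_cochain_refine[OF rv(1)] pull_cochain_refine[OF rv(2)] .
  moreover have "a \<in> cech_reps Y G (Suc n)" "b \<in> cech_reps Y G (Suc n)"
    using rel by (auto simp: cech_rel_iff)
  ultimately show ?thesis
    unfolding cech_rel_iff using W(1) rv pull_reps[OF _ f U] pull_reps[OF _ f U'] by auto
qed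

lemma cech_rel_refl: "a \<in> cech_reps X G (Suc n) \<Longrightarrow> cech_rel X G (Suc n) a a"
  unfolding cech_rel_iff
  by (auto simp: cech_reps_iff refine_proj_def cocycles_iff
      intro!: exI[of _ "fst a"] exI[of _ id] cohomologous_refl pull_cochain_cochains cochains_closed)

lemma cech_rel_sym: "cech_rel X G (Suc n) a b \<Longrightarrow> cech_rel X G (Suc n) b a"
  unfolding cech_rel_iff using cohomologous_sym by blast

text \<open>The two relations are witnessed on unrelated covers. By
  \<open>cech_rel_eventually\<close> both persist on one common refinement, and there the same
  vertex map can serve for the middle term.\<close>

lemma cech_rel_trans:
  assumes ab: "cech_rel X G (Suc n) a b" and bc: "cech_rel X G (Suc n) b c"
  shows "cech_rel X G (Suc n) a c"
proof -
  have r: "a \<in> cech_reps X G (Suc n)" "b \<in> cech_reps X G (Suc n)" "c \<in> cech_reps X G (Suc n)"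
    using ab bc by (auto simp: cech_rel_iff)
  obtain \<W>\<^sub>1 where W1: "fin_open_cover X \<W>\<^sub>1"
    "\<forall>\<W> r p q. refine_proj \<W> \<W>\<^sub>1 r \<longrightarrow> along X (\<lambda>x. x) \<W> (fst a) p \<longrightarrow> along X (\<lambda>x. x) \<W> (fst b) q \<longrightarrow>
      cohomologous X \<W> (Suc n) (pull_cochain X G \<W> (Suc n) p (snd a)) (pull_cochain X G \<W> (Suc n) q (snd b))"
    by (rule cech_rel_eventually[OF ab continuous_map_id[unfolded id_def]])
  obtain \<W>\<^sub>2 where W2: "fin_open_cover X \<W>\<^sub>2"
    "\<forall>\<W> r p q. refine_proj \<W> \<W>\<^sub>2 r \<longrightarrow> along X (\<lambda>x. x) \<W> (fst b) p \<longrightarrow> along X (\<lambda>x. x) \<W> (fst c) q \<longrightarrow>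
      cohomologous X \<W> (Suc n) (pull_cochain X G \<W> (Suc n) p (snd b)) (pull_cochain X G \<W> (Suc n) q (snd c))"
    by (rule cech_rel_eventually[OF bc continuous_map_id[unfolded id_def]])
  obtain \<A> a1 a2 where A: "fin_open_cover X \<A>" "refine_proj \<A> \<W>\<^sub>1 a1" "refine_proj \<A> \<W>\<^sub>2 a2"
    by (rule common_refinement[OF W1(1) W2(1)])
  obtain \<B> b1 b2 where B: "fin_open_cover X \<B>" "refine_proj \<B> (fst a) b1" "refine_proj \<B> (fst b) b2"
    using common_refinement r(1,2) unfolding cech_reps_iff by metis
  obtain \<C> c1 c2 where C: "fin_open_cover X \<C>" "refine_proj \<C> \<B> c1" "refine_proj \<C> (fst c) c2"
    using common_refinement[OF B(1)] r(3) unfolding cech_reps_iff by metis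
  obtain \<W> w1 w2 where W: "fin_open_cover X \<W>" "refine_proj \<W> \<A> w1" "refine_proj \<W> \<C> w2"
    by (rule common_refinement[OF A(1) C(1)])
  have ref: "refine_proj \<W> \<W>\<^sub>1 (a1 \<circ> w1)" "refine_proj \<W> \<W>\<^sub>2 (a2 \<circ> w1)"
    "refine_proj \<W> (fst a) (b1 \<circ> c1 \<circ> w2)" "refine_proj \<W> (fst b) (b2 \<circ> c1 \<circ> w2)"
    "refine_proj \<W> (fst c) (c2 \<circ> w2)"
    by (intro refine_proj_comp[OF W(2) A(2)] refine_proj_comp[OF W(2) A(3)]
        refine_proj_comp[OF W(3) refine_proj_comp[OF C(2) B(2)]]
        refine_proj_comp[OF W(3) refine_proj_comp[OF C(2) B(3)]] refine_proj_comp[OF W(3) C(3)])+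
  have "cohomologous X \<W> (Suc n) (pull_cochain X G \<W> (Suc n) (b1 \<circ> c1 \<circ> w2) (snd a))
     (pull_cochain X G \<W> (Suc n) (c2 \<circ> w2) (snd c))"
    using W1(2)[rule_format, OF ref(1)] W2(2)[rule_format, OF ref(2)] ref(3-5)[THEN refine_proj_along, of X]
    by (meson cohomologous_trans)
  then show ?thesis unfolding cech_rel_iff using r ref W(1) by blast
qed

lemma cech_class_eqI: "cech_rel X G (Suc n) a b \<Longrightarrow> cech_class X G (Suc n) a = cech_class X G (Suc n) b"
  unfolding cech_class_def using cech_rel_sym cech_rel_trans by blast

lemma cech_class_refine:
  assumes "(\<U>, z) \<in> cech_reps X G (Suc n)" "fin_open_cover X \<W>" "refine_proj \<W> \<U> p"
  shows "cech_class X G (Suc n) (\<U>, z) = cech_class X G (Suc n) (\<W>, pull_cochain X G \<W> (Suc n) p z)"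
proof (rule cech_class_eqI)
  have z: "z \<in> cochains X G \<U> (Suc n)" using assms by (auto simp: cech_reps_iff cocycles_iff)
  have "pull_cochain X G \<U> (Suc n) (\<lambda>x. x) z = z"
    using z by (auto simp: pull_cochain_def fun_eq_iff cochains_def)
  moreover have "along X (\<lambda>x. x) \<U> \<U> (\<lambda>x. x)" by (auto simp: along_def)
  ultimately show "cech_rel X G (Suc n) (\<U>, z) (\<W>, pull_cochain X G \<W> (Suc n) p z)"
    using cech_rel_pull[OF cech_rel_refl[OF assms(1)] continuous_map_id[unfolded id_def], of \<U> "\<lambda>x. x" \<W> p]
      assms refine_proj_along[OF assms(3)] by (simp add: cech_reps_iff)
qed

lemma cech_class_cohomologous:
  assumes "fin_open_cover X \<W>" "z \<in> cocycles X G \<W> (Suc n)" "w \<in> cocycles X G \<W> (Suc n)"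
    "cohomologous X \<W> (Suc n) z w"
  shows "cech_class X G (Suc n) (\<W>, z) = cech_class X G (Suc n) (\<W>, w)"
proof (rule cech_class_eqI)
  have "pull_cochain X G \<W> (Suc n) (\<lambda>x. x) c = c" if "c \<in> cocycles X G \<W> (Suc n)" for c
    using that by (auto simp: pull_cochain_def fun_eq_iff cocycles_iff cochains_def)
  then show "cech_rel X G (Suc n) (\<W>, z) (\<W>, w)"
    unfolding cech_rel_iff using assms
    by (auto simp: cech_reps_iff refine_proj_def intro!: exI[of _ \<W>] exI[of _ "\<lambda>x. x"])
qed

lemma cech_class_memD: "b \<in> cech_class X G n a \<Longrightarrow> cech_rel X G n a b"
  by (simp add: cech_class_def)

text \<open>By \<open>cech_rel_pull\<close> all choices open to \<open>cech_hom\<close> yield one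
  class. The freedom in \<open>\<W>\<close> and \<open>p\<close> matters: the image can be computed
  on the staircase cover itself instead of on a cover by preimages.\<close>

lemma cech_hom_class:
  assumes a: "a \<in> cech_reps Y G (Suc n)" and f: "continuous_map X Y f"
    and W: "fin_open_cover X \<W>" "along X f \<W> (fst a) p"
  shows "cech_hom X Y G (Suc n) f (cech_class Y G (Suc n) a) =
    cech_class X G (Suc n) (\<W>, pull_cochain X G \<W> (Suc n) p (snd a))"
proof -
  let ?B = "\<lambda>b. cech_class X G (Suc n) (pull_cover X f (fst b),
       pull_cochain X G (pull_cover X f (fst b)) (Suc n) (cover_section X f (fst b)) (snd b))"
  have eq: "?B b = cech_class X G (Suc n) (\<W>, pull_cochain X G \<W> (Suc n) p (snd a))"
    if "b \<in> cech_class Y G (Suc n) a" for b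
  proof (rule cech_class_eqI, rule cech_rel_sym, rule cech_rel_pull[OF _ f W])
    show rel: "cech_rel Y G (Suc n) a b" using that by (rule cech_class_memD)
    then show "fin_open_cover X (pull_cover X f (fst b))"
      by (auto simp: cech_rel_iff cech_reps_iff intro: fin_open_cover_pull[OF f])
  qed (rule along_cover_section)
  have "a \<in> cech_class Y G (Suc n) a" using cech_rel_refl[OF a] by (simp add: cech_class_def)
  then have "\<exists>B. \<exists>b\<in>cech_class Y G (Suc n) a. B = ?B b" by blast
  then have "\<exists>b\<in>cech_class Y G (Suc n) a. cech_hom X Y G (Suc n) f (cech_class Y G (Suc n) a) = ?B b"
    unfolding cech_hom_def by (rule someI_ex)
  then show ?thesis using eq by auto
qed

text \<open>The choice made by the multiplication is harmless: any representatives, multiplied on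
  any common refinement, become cohomologous to the given ones after one further refinement.\<close>

lemma cech_mult_class:
  assumes w1: "(\<W>, w1) \<in> cech_reps X G (Suc n)" and w2: "(\<W>, w2) \<in> cech_reps X G (Suc n)"
  shows "cech_class X G (Suc n) (\<W>, w1) \<otimes>\<^bsub>cech_group X G (Suc n)\<^esub> cech_class X G (Suc n) (\<W>, w2) =
    cech_class X G (Suc n) (\<W>, cmult G w1 w2)"
proof -
  let ?Q = "\<lambda>C. \<exists>a\<in>cech_class X G (Suc n) (\<W>, w1). \<exists>b\<in>cech_class X G (Suc n) (\<W>, w2).
      \<exists>\<V> p q. fin_open_cover X \<V> \<and> refine_proj \<V> (fst a) p \<and> refine_proj \<V> (fst b) q \<and>
      C = cech_class X G (Suc n)
            (\<V>, cmult G (pull_cochain X G \<V> (Suc n) p (snd a)) (pull_cochain X G \<V> (Suc n) q (snd b)))"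
  have W: "fin_open_cover X \<W>" "w1 \<in> cocycles X G \<W> (Suc n)" "w2 \<in> cocycles X G \<W> (Suc n)"
    using w1 w2 by (auto simp: cech_reps_iff)
  have eq: "C = cech_class X G (Suc n) (\<W>, cmult G w1 w2)" if "?Q C" for C
  proof -
    from that obtain a b \<V> p q where rel: "cech_rel X G (Suc n) (\<W>, w1) a" "cech_rel X G (Suc n) (\<W>, w2) b"
      and V: "fin_open_cover X \<V>" and p: "refine_proj \<V> (fst a) p" and q: "refine_proj \<V> (fst b) q"
      and C: "C = cech_class X G (Suc n)
            (\<V>, cmult G (pull_cochain X G \<V> (Suc n) p (snd a)) (pull_cochain X G \<V> (Suc n) q (snd b)))"
      by (auto dest!: cech_class_memD)
    let ?a = "pull_cochain X G \<V> (Suc n) p (snd a)" and ?b = "pull_cochain X G \<V> (Suc n) q (snd b)"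
    have ab: "a \<in> cech_reps X G (Suc n)" "b \<in> cech_reps X G (Suc n)"
      using rel by (auto simp: cech_rel_iff)
    have abV: "?a \<in> cocycles X G \<V> (Suc n)" "?b \<in> cocycles X G \<V> (Suc n)"
      using pull_reps[OF ab(1) continuous_map_id[unfolded id_def] V refine_proj_along[OF p]]
        pull_reps[OF ab(2) continuous_map_id[unfolded id_def] V refine_proj_along[OF q]] by (auto simp: cech_reps_iff)
    obtain \<A> where A: "fin_open_cover X \<A>"
      "\<forall>\<B> r s t. refine_proj \<B> \<A> s \<longrightarrow> along X (\<lambda>x. x) \<B> \<W> t \<longrightarrow> along X (\<lambda>x. x) \<B> (fst a) r \<longrightarrow>
      cohomologous X \<B> (Suc n) (pull_cochain X G \<B> (Suc n) t w1) (pull_cochain X G \<B> (Suc n) r (snd a))"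
      by (rule cech_rel_eventually[OF rel(1) continuous_map_id[unfolded id_def]]) auto
    obtain \<A>' where A': "fin_open_cover X \<A>'"
      "\<forall>\<B> r s t. refine_proj \<B> \<A>' s \<longrightarrow> along X (\<lambda>x. x) \<B> \<W> t \<longrightarrow> along X (\<lambda>x. x) \<B> (fst b) r \<longrightarrow>
      cohomologous X \<B> (Suc n) (pull_cochain X G \<B> (Suc n) t w2) (pull_cochain X G \<B> (Suc n) r (snd b))"
      by (rule cech_rel_eventually[OF rel(2) continuous_map_id[unfolded id_def]]) auto
    obtain \<C> c1 c2 where Cc: "fin_open_cover X \<C>" "refine_proj \<C> \<A> c1" "refine_proj \<C> \<A>' c2"
      by (rule common_refinement[OF A(1) A'(1)])
    obtain \<D> d1 d2 where D: "fin_open_cover X \<D>" "refine_proj \<D> \<W> d1" "refine_proj \<D> \<V> d2"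
      by (rule common_refinement[OF W(1) V])
    obtain \<B> e1 e2 where B: "fin_open_cover X \<B>" "refine_proj \<B> \<C> e1" "refine_proj \<B> \<D> e2"
      by (rule common_refinement[OF Cc(1) D(1)])
    have ref: "refine_proj \<B> \<A> (c1 \<circ> e1)" "refine_proj \<B> \<A>' (c2 \<circ> e1)" "refine_proj \<B> \<W> (d1 \<circ> e2)"
      "refine_proj \<B> \<V> (d2 \<circ> e2)" "refine_proj \<B> (fst a) (p \<circ> (d2 \<circ> e2))" "refine_proj \<B> (fst b) (q \<circ> (d2 \<circ> e2))"
      by (intro refine_proj_comp[OF B(2) Cc(2)] refine_proj_comp[OF B(2) Cc(3)]
          refine_proj_comp[OF B(3) D(2)] refine_proj_comp[OF B(3) D(3)]
          refine_proj_comp[OF refine_proj_comp[OF B(3) D(3)] p]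
          refine_proj_comp[OF refine_proj_comp[OF B(3) D(3)] q])+
    note al = ref[THEN refine_proj_along, of X]
    have "cohomologous X \<B> (Suc n)
      (cmult G (pull_cochain X G \<B> (Suc n) (d1 \<circ> e2) w1) (pull_cochain X G \<B> (Suc n) (d1 \<circ> e2) w2))
      (cmult G (pull_cochain X G \<B> (Suc n) (p \<circ> (d2 \<circ> e2)) (snd a))
        (pull_cochain X G \<B> (Suc n) (q \<circ> (d2 \<circ> e2)) (snd b)))"
      by (intro cohomologous_cmult A(2)[rule_format, OF ref(1)] A'(2)[rule_format, OF ref(2)] al)
    then have "cohomologous X \<B> (Suc n) (pull_cochain X G \<B> (Suc n) (d1 \<circ> e2) (cmult G w1 w2))
      (pull_cochain X G \<B> (Suc n) (d2 \<circ> e2) (cmult G ?a ?b))"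
      unfolding pull_cochain_cmult pull_cochain_refine[OF ref(4)] .
    then have "cech_rel X G (Suc n) (\<W>, cmult G w1 w2) (\<V>, cmult G ?a ?b)"
      unfolding cech_rel_iff using W V abV ref B(1) by (auto simp: cech_reps_iff cmult_cocycles)
    from cech_class_eqI[OF this] show ?thesis using C by simp
  qed
  have "(\<W>, w1) \<in> cech_class X G (Suc n) (\<W>, w1)" "(\<W>, w2) \<in> cech_class X G (Suc n) (\<W>, w2)"
    using cech_rel_refl[OF w1] cech_rel_refl[OF w2] by (auto simp: cech_class_def)
  moreover have "refine_proj \<W> \<W> (\<lambda>x. x)" by (simp add: refine_proj_def)
  ultimately have "\<exists>C. ?Q C"
    using W(1) by (intro exI bexI conjI) (auto intro: refl)
  then have "?Q (SOME C. ?Q C)" by (rule someI_ex)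
  then show ?thesis using eq by (simp add: cech_group_def)
qed

end

section \<open>Balanced covers\<close>

text \<open>\<open>insert_sorted\<close> and \<open>alternate\<close> express a simplex with distinctly coloured vertices as the
  signed simplex sorted by colour, as in the exterior algebra.\<close>

primrec insert_sorted :: "('v \<Rightarrow> nat) \<Rightarrow> 'v \<Rightarrow> 'v list \<Rightarrow> 'v chain" where
  "insert_sorted col x [] = frag_of [x]"
| "insert_sorted col x (y # ys) = (if col x < col y then frag_of (x # y # ys)
     else if col x = col y then 0 else - cone y (insert_sorted col x ys))"

primrec alternate :: "('v \<Rightarrow> nat) \<Rightarrow> 'v list \<Rightarrow> 'v chain" where
  "alternate col [] = frag_of []"
| "alternate col (x # xs) = frag_extend (insert_sorted col x) (alternate col xs)"

abbreviation colour_sorted :: "('v \<Rightarrow> nat) \<Rightarrow> 'v list \<Rightarrow> bool" where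
  "colour_sorted col \<equiv> sorted_wrt (\<lambda>a b. col a < col b)"

lemma keys_insert_sorted:
  "s \<in> Poly_Mapping.keys (insert_sorted col x ys) \<Longrightarrow> colour_sorted col ys \<Longrightarrow>
    colour_sorted col s \<and> length s = Suc (length ys) \<and> set s \<subseteq> insert x (set ys)"
proof (induction ys arbitrary: s)
  case (Cons y ys)
  show ?case
  proof (cases "col x < col y")
    case True
    then have "s = x # y # ys" using Cons.prems by simp
    then show ?thesis using True Cons.prems by auto
  next
    case False
    then have "col y < col x" "s \<in> Poly_Mapping.keys (cone y (insert_sorted col x ys))"
      using Cons.prems by (auto split: if_splits)
    then obtain t where t: "t \<in> Poly_Mapping.keys (insert_sorted col x ys)" "s = y # t"
      by (auto dest: keys_cone)
    with Cons have "colour_sorted col t \<and> length t = Suc (length ys) \<and> set t \<subseteq> insert x (set ys)" by auto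
    then show ?thesis using t Cons.prems \<open>col y < col x\<close> by auto
  qed
qed simp

lemma keys_alternate:
  "s \<in> Poly_Mapping.keys (alternate col t) \<Longrightarrow>
    colour_sorted col s \<and> length s = length t \<and> set s \<subseteq> set t"
proof (induction t arbitrary: s)
  case (Cons x xs)
  then obtain u where u: "u \<in> Poly_Mapping.keys (alternate col xs)"
    "s \<in> Poly_Mapping.keys (insert_sorted col x u)"
    by (auto dest: keys_frag_extendD)
  then show ?case using Cons.IH[OF u(1)] keys_insert_sorted[OF u(2)] by auto
qed simp

lemma insert_sorted_less:
  "(\<And>y. y \<in> set s \<Longrightarrow> col x < col y) \<Longrightarrow> insert_sorted col x s = frag_of (x # s)"
  by (cases s) auto

lemma insert_sorted_cone:
  assumes "col y < col x"
  shows "frag_extend (insert_sorted col x) (cone y c) = - cone y (frag_extend (insert_sorted col x) c)"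
  using subset_UNIV[of "Poly_Mapping.keys c"]
  by (induction c rule: frag_induction) (use assms in \<open>auto simp: frag_linear\<close>)

text \<open>Inserting \<open>x\<close> is exterior multiplication by \<open>x\<close>, and this is
  the rule that the boundary of the product of \<open>x\<close> and \<open>w\<close> is
  \<open>w\<close> minus the product of \<open>x\<close> and the boundary of
  \<open>w\<close>.\<close>

lemma Bd_insert_sorted:
  assumes "colour_sorted col ys" "\<And>y. y \<in> set ys \<Longrightarrow> col y = col x \<Longrightarrow> y = x"
  shows "frag_extend bd (insert_sorted col x ys) =
    frag_of ys - frag_extend (insert_sorted col x) (bd ys)"
  using assms
proof (induction ys)
  case (Cons y ys)
  consider "col x < col y" | "col x = col y" | "col y < col x" by linarith
  then show ?case
  proof cases
    case 1
    have "frag_extend (insert_sorted col x) (bd (y # ys)) = cone x (bd (y # ys))"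
      by (intro frag_extend_eq insert_sorted_less)
        (use 1 Cons.prems(1) keys_bd[of _ "y # ys"] in fastforce)
    then show ?thesis using 1 by simp
  next
    case 2
    \<comment> \<open>The left side is 0. On the right, the face that omits \<open>y\<close> gets
      \<open>x\<close> back and cancels the simplex; the other faces still contain \<open>x\<close>
      and die.\<close>
    then have "y = x" using Cons.prems(2)[of y] by simp
    moreover have "insert_sorted col x ys = frag_of (x # ys)"
      using Cons.prems(1) 2 by (intro insert_sorted_less) auto
    moreover have "frag_extend (insert_sorted col x) (cone x (bd ys)) = 0"
      unfolding frag_extend_extend by (simp add: frag_extend_eq_0)
    ultimately show ?thesis using 2 by (simp add: frag_linear)
  next
    case 3
    then show ?thesis using Cons
      by (simp add: frag_linear Bd_cone insert_sorted_cone)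
  qed
qed simp

text \<open>Injectivity is required on the set of vertices only, so \<open>t\<close> may repeat a
  vertex, as Cech tuples do; such a \<open>t\<close> alternates to 0.\<close>

lemma Bd_alternate:
  "inj_on col (set t) \<Longrightarrow> frag_extend bd (alternate col t) = frag_extend (alternate col) (bd t)"
proof (induction t)
  case (Cons x xs)
  have "frag_extend bd (alternate col (x # xs)) =
      frag_extend (\<lambda>s. frag_of s - frag_extend (insert_sorted col x) (bd s)) (alternate col xs)"
    unfolding alternate.simps frag_extend_extend
  proof (intro frag_extend_eq Bd_insert_sorted)
    fix s y assume "s \<in> Poly_Mapping.keys (alternate col xs)" "y \<in> set s" "col y = col x"
    then show "y = x" using keys_alternate[of s col xs] Cons.prems by (auto simp: inj_on_def)
  qed (use keys_alternate in blast)
  also have "\<dots> = alternate col xs - frag_extend (insert_sorted col x) (frag_extend (alternate col) (bd xs))"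
    using Cons by (simp add: frag_extend_fun_diff frag_extend_extend[symmetric] frag_expansion[symmetric])
  finally show ?case
    by (simp add: frag_linear frag_extend_extend)
qed simp

lemma insert_sorted_map:
  assumes "col' (p x) = col x" "\<And>y. y \<in> set ys \<Longrightarrow> col' (p y) = col y"
  shows "insert_sorted col' (p x) (map p ys) =
    frag_extend (\<lambda>s. frag_of (map p s)) (insert_sorted col x ys)"
  using assms(2)
proof (induction ys)
  case (Cons y ys)
  have "frag_extend (\<lambda>s. frag_of (map p s)) (cone y c) = cone (p y) (frag_extend (\<lambda>s. frag_of (map p s)) c)"
    for c by (simp add: frag_extend_extend)
  with Cons show ?case using assms(1) by (simp add: frag_linear)
qed simp

lemma alternate_map:
  assumes "\<And>y. y \<in> set t \<Longrightarrow> col' (p y) = col y"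
  shows "alternate col' (map p t) = frag_extend (\<lambda>s. frag_of (map p s)) (alternate col t)"
  using assms
proof (induction t)
  case (Cons x xs)
  have "alternate col' (map p (x # xs)) =
      frag_extend (\<lambda>s. insert_sorted col' (p x) (map p s)) (alternate col xs)"
    using Cons by (simp add: frag_extend_extend)
  also have "\<dots> = frag_extend (\<lambda>s. frag_extend (\<lambda>s. frag_of (map p s)) (insert_sorted col x s)) (alternate col xs)"
    using Cons.prems keys_alternate[of _ col xs] by (intro frag_extend_eq insert_sorted_map) auto
  finally show ?case by (simp add: frag_extend_extend)
qed simp

text \<open>Pigeonhole: a colour-sorted list has distinct colours, and only \<open>n + 1\<close> are
  available.\<close>

lemma alternate_eq_0:
  assumes "\<And>x. x \<in> set t \<Longrightarrow> col x \<le> n" "Suc n < length t"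
  shows "alternate col t = 0"
proof (rule ccontr)
  assume "alternate col t \<noteq> 0"
  then obtain s where "s \<in> Poly_Mapping.keys (alternate col t)" by (meson all_not_in_conv keys_eq_empty)
  then have s: "colour_sorted col s" "length s = length t" "set s \<subseteq> set t" by (auto dest: keys_alternate)
  from s(1) have "distinct (map col s)" by (induction s) auto
  then have "length s = card (col ` set s)" using distinct_card by fastforce
  also have "\<dots> \<le> card {..n}" by (intro card_mono) (use s assms in auto)
  finally show False using s assms by simp
qed

section \<open>Alternating and elementary cocycles on balanced covers\<close>

definition balanced :: "'a topology \<Rightarrow> 'a set set \<Rightarrow> ('a set \<Rightarrow> nat) \<Rightarrow> nat \<Rightarrow> bool" where
  "balanced X \<W> col n \<longleftrightarrow> (\<forall>A\<in>\<W>. col A \<le> n) \<and>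
     (\<forall>A\<in>\<W>. \<forall>B\<in>\<W>. topspace X \<inter> A \<inter> B \<noteq> {} \<longrightarrow> col A = col B \<longrightarrow> A = B)"

lemma balanced_inj_on:
  assumes "balanced X \<W> col n" "in_nerve X \<W> t"
  shows "inj_on col (set t)"
proof (rule inj_onI)
  fix A B assume AB: "A \<in> set t" "B \<in> set t" "col A = col B"
  then have "topspace X \<inter> A \<inter> B \<noteq> {}" "A \<in> \<W>" "B \<in> \<W>"
    using assms(2) unfolding in_nerve_def by blast+
  then show "A = B" using assms(1) AB unfolding balanced_def by blast
qed

context comm_group
begin

text \<open>Only the values of \<open>c\<close> at colour-sorted simplices count; the others are
  recomputed from them.\<close>

definition alt_cochain ::
  "'x topology \<Rightarrow> 'x set set \<Rightarrow> ('x set \<Rightarrow> nat) \<Rightarrow> nat \<Rightarrow> ('x set list \<Rightarrow> 'a) \<Rightarrow> 'x set list \<Rightarrow> 'a" where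
  "alt_cochain X \<W> col n c = (\<lambda>\<sigma>. if \<sigma> \<in> nerve_tuples X \<W> n then ev c (alternate col \<sigma>) else \<one>)"

lemma alt_cochain_cochains:
  "(\<And>s. c s \<in> carrier G) \<Longrightarrow> alt_cochain X \<W> col n c \<in> cochains X G \<W> n"
  by (auto simp: alt_cochain_def cochains_def)

text \<open>No cocycle condition is imposed on \<open>c\<close>: the alternation is a chain map, and
  it kills the simplices of dimension \<open>n + 1\<close>.\<close>

lemma alt_cochain_cocycle:
  assumes bal: "balanced X \<W> col n" and c: "\<And>s. c s \<in> carrier G"
  shows "alt_cochain X \<W> col n c \<in> cocycles X G \<W> n"
  unfolding cocycles_iff
proof (intro conjI ballI alt_cochain_cochains c)
  fix \<sigma> assume \<sigma>: "\<sigma> \<in> nerve_tuples X \<W> (Suc n)"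
  then have n: "in_nerve X \<W> \<sigma>" "length \<sigma> = Suc (Suc n)" by (auto simp: nerve_tuples_iff)
  have "alternate col \<sigma> = 0"
    by (rule alternate_eq_0[of _ _ n]) (use bal n in \<open>auto simp: balanced_def in_nerve_def\<close>)
  have "ev (alt_cochain X \<W> col n c) (bd \<sigma>) = ev (\<lambda>s. ev c (alternate col s)) (bd \<sigma>)"
    by (rule ev_cong) (use \<sigma> c in \<open>auto simp: alt_cochain_def dest: nerve_tuples_bd\<close>)
  also have "\<dots> = ev c (frag_extend bd (alternate col \<sigma>))"
    unfolding Bd_alternate[OF balanced_inj_on[OF bal n(1)]] using c by (simp add: ev_frag_extend)
  finally show "ev (alt_cochain X \<W> col n c) (bd \<sigma>) = \<one>"
    using \<open>alternate col \<sigma> = 0\<close> by simp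
qed

text \<open>The identity and the alternation are chain maps that keep to the vertices of each
  simplex, so \<open>homotopy_coboundary\<close> applies to their difference.\<close>

lemma alt_cochain_cohomologous:
  assumes bal: "balanced X \<W> col m" and z: "z \<in> cocycles X G \<W> (Suc n)"
  shows "cohomologous X \<W> (Suc n) z (alt_cochain X \<W> col (Suc n) z)"
proof -
  define F where "F t = frag_of t - alternate col t" for t
  have zc: "\<And>s. z s \<in> carrier G" and z': "z \<in> cochains X G \<W> (Suc n)"
    using z by (auto simp: cocycles_iff cochains_closed)
  have "along X (\<lambda>x. x) \<W> \<W> (\<lambda>x. x)" by (auto simp: along_def)
  then have "\<exists>b\<in>cochains X G \<W> n. \<forall>\<sigma>\<in>nerve_tuples X \<W> (Suc n). ev z (F \<sigma>) = ev b (bd \<sigma>)"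
  proof (rule homotopy_coboundary[OF z])
    show "frag_extend bd (F t) = frag_extend F (bd t)" if "in_nerve X \<W> t" for t
      unfolding F_def frag_extend_fun_diff
      using Bd_alternate[OF balanced_inj_on[OF bal that]]
      by (simp add: frag_linear frag_expansion[symmetric])
    show "F [] = 0" by (simp add: F_def)
    show "length s = length t \<and> set s \<subseteq> {V\<in>\<W>. (\<lambda>x. x) ` (topspace X \<inter> \<Inter>(set t)) \<subseteq> V}"
      if "in_nerve X \<W> t" "s \<in> Poly_Mapping.keys (F t)" for s t
    proof -
      have "length s = length t \<and> set s \<subseteq> set t"
        using that(2) by (auto simp: F_def dest!: keys_diffD keys_alternate)
      then show ?thesis using that(1) by (auto simp: in_nerve_def)
    qed
  qed simp
  then obtain b where b: "b \<in> cochains X G \<W> n"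
    "\<And>\<sigma>. \<sigma> \<in> nerve_tuples X \<W> (Suc n) \<Longrightarrow> z \<sigma> \<otimes> inv ev z (alternate col \<sigma>) = ev b (bd \<sigma>)"
    by (auto simp: F_def ev_diff zc)
  have "z \<sigma> = ev b (bd \<sigma>) \<otimes> ev z (alternate col \<sigma>)" if "\<sigma> \<in> nerve_tuples X \<W> (Suc n)" for \<sigma>
    by (rule mult_inv_eqD) (use that zc b(2) in auto)
  then show ?thesis
    unfolding cohomologous_iff using b(1) z' alt_cochain_cochains[OF zc, of X \<W> col "Suc n"]
    by (fastforce simp: alt_cochain_def)
qed

text \<open>If \<open>\<gamma>\<close> is not colour-sorted, this is the trivial cocycle, so
  \<open>\<gamma>\<close> may range over all tuples of the nerve.\<close>

definition elementary ::
  "'x topology \<Rightarrow> 'x set set \<Rightarrow> ('x set \<Rightarrow> nat) \<Rightarrow> nat \<Rightarrow> 'x set list \<Rightarrow> 'a \<Rightarrow> 'x set list \<Rightarrow> 'a" where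
  "elementary X \<W> col n \<gamma> g = alt_cochain X \<W> col n (\<lambda>s. if s = \<gamma> then g else \<one>)"

lemma elementary_cocycle:
  "balanced X \<W> col n \<Longrightarrow> g \<in> carrier G \<Longrightarrow> elementary X \<W> col n \<gamma> g \<in> cocycles X G \<W> n"
  unfolding elementary_def by (rule alt_cochain_cocycle) auto

text \<open>A vertex map that preserves colours commutes with the alternation, so it suffices to
  compare values on lists, where by \<open>inj\<close> only \<open>\<gamma>\<close> lies over
  \<open>map p \<gamma>\<close>. Injectivity elsewhere is not asked for; the folding would not have
  it.\<close>

lemma pull_elementary:
  assumes p: "along X f \<W> \<V> p" and f: "f \<in> topspace X \<rightarrow> topspace Y"
    and col: "\<And>A. A \<in> \<W> \<Longrightarrow> col' (p A) = col A" and g: "g \<in> carrier G"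
    and inj: "\<And>s. set s \<subseteq> \<W> \<Longrightarrow> map p s = map p \<gamma> \<Longrightarrow> s = \<gamma>"
  shows "pull_cochain X G \<W> n p (elementary Y \<V> col' n (map p \<gamma>) g) = elementary X \<W> col n \<gamma> g"
proof
  fix \<sigma>
  let ?c = "\<lambda>\<gamma> s. if s = \<gamma> then g else \<one>"
  show "pull_cochain X G \<W> n p (elementary Y \<V> col' n (map p \<gamma>) g) \<sigma> = elementary X \<W> col n \<gamma> g \<sigma>"
  proof (cases "\<sigma> \<in> nerve_tuples X \<W> n")
    case True
    then have \<sigma>: "map p \<sigma> \<in> nerve_tuples Y \<V> n" "set \<sigma> \<subseteq> \<W>"
      using nerve_tuples_map[OF p f] by (auto simp: nerve_tuples_iff in_nerve_def)
    have "alternate col' (map p \<sigma>) = frag_extend (\<lambda>s. frag_of (map p s)) (alternate col \<sigma>)"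
      by (rule alternate_map) (use \<sigma> col in auto)
    then have "ev (?c (map p \<gamma>)) (alternate col' (map p \<sigma>)) =
        ev (\<lambda>s. ?c (map p \<gamma>) (map p s)) (alternate col \<sigma>)"
      using g by (simp add: ev_frag_extend)
    also have "\<dots> = ev (?c \<gamma>) (alternate col \<sigma>)"
    proof (rule ev_cong)
      fix s assume "s \<in> Poly_Mapping.keys (alternate col \<sigma>)"
      then have "set s \<subseteq> \<W>" using keys_alternate[of s] \<sigma> by auto
      then show "?c (map p \<gamma>) (map p s) = ?c \<gamma> s" using inj by auto
    qed (use g in auto)
    finally show ?thesis using True \<sigma> by (simp add: pull_cochain_def elementary_def alt_cochain_def)
  qed (simp add: pull_cochain_def elementary_def alt_cochain_def)
qed

lemma finite_nerve_tuples: "finite \<W> \<Longrightarrow> finite (nerve_tuples X \<W> n)"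
  using finite_lists_length_eq[of \<W> "Suc n"]
  by (rule finite_subset[rotated]) (auto simp: nerve_tuples_def)

text \<open>The alternation of \<open>z\<close> is the product, over the finitely many tuples of the
  nerve, of the elementary cocycles with the values of \<open>z\<close>.\<close>

lemma cech_class_balanced_in_subgroup:
  assumes H: "subgroup H (cech_group X G (Suc n))"
    and W: "fin_open_cover X \<W>" and bal: "balanced X \<W> col (Suc n)"
    and z: "z \<in> cocycles X G \<W> (Suc n)"
    and el: "\<And>\<gamma> g. \<gamma> \<in> nerve_tuples X \<W> (Suc n) \<Longrightarrow> g \<in> carrier G \<Longrightarrow>
      cech_class X G (Suc n) (\<W>, elementary X \<W> col (Suc n) \<gamma> g) \<in> H"
  shows "cech_class X G (Suc n) (\<W>, z) \<in> H"
proof -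
  let ?N = "nerve_tuples X \<W> (Suc n)"
  have zc: "\<And>s. z s \<in> carrier G" using z by (auto simp: cocycles_iff cochains_closed)
  \<comment> \<open>\<open>w T\<close> keeps the values of \<open>z\<close> on \<open>T\<close>
    only; it interpolates between the trivial cocycle and the alternation of
    \<open>z\<close>.\<close>
  define w where "w T = alt_cochain X \<W> col (Suc n) (\<lambda>s. if s \<in> T then z s else \<one>)" for T
  have wcoc: "w T \<in> cocycles X G \<W> (Suc n)" for T
    unfolding w_def by (rule alt_cochain_cocycle[OF bal]) (use zc in auto)
  have w_insert: "w (insert \<gamma> T) = cmult G (elementary X \<W> col (Suc n) \<gamma> (z \<gamma>)) (w T)"
    if "\<gamma> \<notin> T" for \<gamma> T
  proof
    fix \<sigma>
    have "(\<lambda>s. if s \<in> insert \<gamma> T then z s else \<one>) =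
        cmult G (\<lambda>s. if s = \<gamma> then z \<gamma> else \<one>) (\<lambda>s. if s \<in> T then z s else \<one>)"
      using that zc by (auto simp: cmult_def fun_eq_iff)
    then have "ev (\<lambda>s. if s \<in> insert \<gamma> T then z s else \<one>) x =
        ev (\<lambda>s. if s = \<gamma> then z \<gamma> else \<one>) x \<otimes> ev (\<lambda>s. if s \<in> T then z s else \<one>) x" for x
      by (simp only:) (rule ev_cmult, use zc in auto)
    then show "w (insert \<gamma> T) \<sigma> = cmult G (elementary X \<W> col (Suc n) \<gamma> (z \<gamma>)) (w T) \<sigma>"
      by (simp add: w_def alt_cochain_def elementary_def cmult_def)
  qed
  \<comment> \<open>The unit of the group is represented on the one-element cover and has to be
    moved to \<open>\<W>\<close>.\<close>
  have one: "cech_class X G (Suc n) (\<W>, \<lambda>_. \<one>) \<in> H"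
  proof -
    have "fin_open_cover X {topspace X}" by (simp add: fin_open_cover_def)
    moreover have "refine_proj \<W> {topspace X} (\<lambda>_. topspace X)"
      using W by (auto simp: refine_proj_def fin_open_cover_def dest: openin_subset)
    moreover have "pull_cochain X G \<W> (Suc n) (\<lambda>_. topspace X) (\<lambda>_. \<one>) = (\<lambda>_. \<one>)"
      by (auto simp: pull_cochain_def)
    ultimately have "cech_class X G (Suc n) ({topspace X}, \<lambda>_. \<one>) = cech_class X G (Suc n) (\<W>, \<lambda>_. \<one>)"
      using cech_class_refine[of "{topspace X}" "\<lambda>_. \<one>" X n \<W> "\<lambda>_. topspace X"] W
        one_cocycle[of X "{topspace X}" "Suc n"]
      by (simp add: cech_reps_iff)
    then show ?thesis using subgroup.one_closed[OF H] by (simp add: cech_group_def)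
  qed
  have "cech_class X G (Suc n) (\<W>, w T) \<in> H" if "finite T" "T \<subseteq> ?N" for T
    using that
  proof (induction T)
    case empty
    have "w {} = (\<lambda>_. \<one>)" by (auto simp: w_def alt_cochain_def ev_trivial)
    then show ?case using one by simp
  next
    case (insert \<gamma> T)
    let ?e = "elementary X \<W> col (Suc n) \<gamma> (z \<gamma>)"
    have "(\<W>, ?e) \<in> cech_reps X G (Suc n)" "(\<W>, w T) \<in> cech_reps X G (Suc n)"
      using W wcoc elementary_cocycle[OF bal zc] by (auto simp: cech_reps_iff)
    note mult = cech_mult_class[OF this]
    have "cech_class X G (Suc n) (\<W>, ?e) \<in> H" "cech_class X G (Suc n) (\<W>, w T) \<in> H"
      using insert zc by (auto intro: el)
    from subgroup.m_closed[OF H this] show ?case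
      unfolding mult w_insert[OF insert.hyps(2)] .
  qed
  then have "cech_class X G (Suc n) (\<W>, w ?N) \<in> H"
    using finite_nerve_tuples W by (auto simp: fin_open_cover_def)
  moreover have "cohomologous X \<W> (Suc n) z (w ?N)"
  proof -
    have "(\<lambda>s. if s \<in> ?N then z s else \<one>) = z"
      using z by (auto simp: cocycles_iff cochains_def)
    then show ?thesis unfolding w_def using alt_cochain_cohomologous[OF bal z] by simp
  qed
  ultimately show ?thesis
    using cech_class_cohomologous[OF W z wcoc] by simp
qed

lemma elementary_class_in_image:
  assumes f: "continuous_map X Y f" and W: "fin_open_cover X \<W>"
    and V: "fin_open_cover Y \<V>" "balanced Y \<V> col' (Suc n)"
    and p: "along X f \<W> \<V> p" and col: "\<And>A. A \<in> \<W> \<Longrightarrow> col' (p A) = col A" and g: "g \<in> carrier G"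
    and inj: "\<And>s. set s \<subseteq> \<W> \<Longrightarrow> map p s = map p \<gamma> \<Longrightarrow> s = \<gamma>"
  shows "cech_class X G (Suc n) (\<W>, elementary X \<W> col (Suc n) \<gamma> g)
    \<in> cech_hom X Y G (Suc n) f ` carrier (cech_group Y G (Suc n))"
proof
  let ?a = "(\<V>, elementary Y \<V> col' (Suc n) (map p \<gamma>) g)"
  have a: "?a \<in> cech_reps Y G (Suc n)"
    using V elementary_cocycle[OF V(2) g] by (auto simp: cech_reps_iff)
  then show "cech_class Y G (Suc n) ?a \<in> carrier (cech_group Y G (Suc n))"
    by (auto simp: cech_group_def)
  have "f \<in> topspace X \<rightarrow> topspace Y" using f by (auto simp: continuous_map_def)
  with p have "pull_cochain X G \<W> (Suc n) p (elementary Y \<V> col' (Suc n) (map p \<gamma>) g) =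
      elementary X \<W> col (Suc n) \<gamma> g"
    by (rule pull_elementary) (use col g inj in auto)
  then show "cech_class X G (Suc n) (\<W>, elementary X \<W> col (Suc n) \<gamma> g) =
      cech_hom X Y G (Suc n) f (cech_class Y G (Suc n) ?a)"
    using cech_hom_class[OF a f W, of p] p by simp
qed

end

section \<open>Coloured partitions of unity\<close>

text \<open>By compactness finitely many open boxes, each inside a member of \<open>\<U>\<close>,
  cover the product; in each factor the cover consists of the cells cut out by the sides of these
  boxes.\<close>

lemma box_refinement:
  fixes Y :: "'i \<Rightarrow> 'a topology"
  assumes comp: "\<And>i. i \<in> K \<Longrightarrow> compact_space (Y i)"
    and U: "fin_open_cover (product_topology Y K) \<U>"
  obtains \<V> where "\<And>i. i \<in> K \<Longrightarrow> fin_open_cover (Y i) (\<V> i)"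
    "\<And>V. (\<And>i. i \<in> K \<Longrightarrow> V i \<in> \<V> i) \<Longrightarrow> \<exists>U\<in>\<U>. PiE K V \<subseteq> U"
proof -
  let ?X = "product_topology Y K"
  define Q where "Q B \<longleftrightarrow> (\<forall>i\<in>K. openin (Y i) (B i)) \<and> openin ?X (PiE K B) \<and> (\<exists>U\<in>\<U>. PiE K B \<subseteq> U)" for B
  have cover: "\<exists>B. Q B \<and> x \<in> PiE K B" if "x \<in> topspace ?X" for x
  proof -
    have "x \<in> \<Union>\<U>" using that U by (metis fin_open_cover_def)
    then obtain U where U': "U \<in> \<U>" "x \<in> U" "openin ?X U"
      using U unfolding fin_open_cover_def by blast
    then obtain B where B: "finite {i \<in> K. B i \<noteq> topspace (Y i)}" "\<forall>i\<in>K. openin (Y i) (B i)"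
      "x \<in> PiE K B" "PiE K B \<subseteq> U"
      unfolding openin_product_topology_alt by blast
    moreover have "openin ?X (PiE K B)"
      using B by (simp add: openin_PiE_gen)
    ultimately show ?thesis using U' unfolding Q_def by blast
  qed
  have "compact_space ?X" using comp by (simp add: compact_space_product_topology)
  moreover have "topspace ?X \<subseteq> \<Union>(PiE K ` Collect Q)" using cover by blast
  moreover have "\<forall>A\<in>PiE K ` Collect Q. openin ?X A" by (auto simp: Q_def)
  ultimately obtain \<F> where \<F>: "finite \<F>" "\<F> \<subseteq> PiE K ` Collect Q" "topspace ?X \<subseteq> \<Union>\<F>"
    unfolding compact_space_alt by meson
  then obtain F where F: "finite F" "F \<subseteq> Collect Q" "\<F> = PiE K ` F"
    by (meson finite_subset_image)
  \<comment> \<open>The smallest set around \<open>a\<close> that the sides of the boxes determine.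
    A tuple of base points lies in some box, and then all its sets \<open>N i (a i)\<close> lie in
    the sides of that box. If no side contains \<open>a\<close>, the intersection is
    \<open>UNIV\<close>, whence the factor \<open>topspace (Y i)\<close>.\<close>
  define N where "N i a = topspace (Y i) \<inter> (\<Inter>B\<in>{B\<in>F. a \<in> B i}. B i)" for i a
  show thesis
  proof
    fix i assume i: "i \<in> K"
    have "N i ` topspace (Y i) \<subseteq> (\<lambda>F'. topspace (Y i) \<inter> (\<Inter>B\<in>F'. B i)) ` Pow F"
      by (auto simp: N_def)
    then have "finite (N i ` topspace (Y i))"
      by (rule finite_subset) (use F in auto)
    moreover have "openin (Y i) (N i a)" for a
    proof (cases "{B\<in>F. a \<in> B i} = {}")
      case True
      then show ?thesis by (simp only: N_def) simp
    next
      case False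
      have "openin (Y i) (\<Inter>B\<in>{B\<in>F. a \<in> B i}. B i)"
        using F i False by (intro openin_INT2) (auto simp: Q_def)
      then show ?thesis unfolding N_def by auto
    qed
    moreover have "\<Union>(N i ` topspace (Y i)) = topspace (Y i)" by (auto simp: N_def)
    ultimately show "fin_open_cover (Y i) (N i ` topspace (Y i))"
      by (auto simp: fin_open_cover_def)
  next
    fix V assume V: "\<And>i. i \<in> K \<Longrightarrow> V i \<in> N i ` topspace (Y i)"
    then have "\<forall>i\<in>K. \<exists>a. a \<in> topspace (Y i) \<and> V i = N i a" by blast
    then obtain a where a: "\<And>i. i \<in> K \<Longrightarrow> a i \<in> topspace (Y i) \<and> V i = N i (a i)" by metis
    then have "restrict a K \<in> topspace ?X" by simp
    then have "restrict a K \<in> \<Union>(PiE K ` F)" using \<F>(3) F(3) by (metis subsetD)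
    then obtain B where B: "B \<in> F" "restrict a K \<in> PiE K B" by (elim UN_E)
    have "V i \<subseteq> B i" if "i \<in> K" for i
      using a[OF that] B that by (auto simp: N_def PiE_iff)
    then have VB: "PiE K V \<subseteq> PiE K B" by (rule PiE_mono)
    have "Q B" using B F by auto
    then obtain U where "U \<in> \<U>" "PiE K B \<subseteq> U" unfolding Q_def by metis
    then show "\<exists>U\<in>\<U>. PiE K V \<subseteq> U" by (intro bexI[of _ U] subset_trans[OF VB])
  qed
qed

text \<open>The function is the distance to the complement; \<open>U\<close> being the whole space
  is separate because the infimum over the empty set carries no information.\<close>

lemma metrizable_cozero:
  assumes "metrizable_space X" "openin X U"
  obtains f :: "'a \<Rightarrow> real" where "continuous_map X euclideanreal f"
    "\<forall>x\<in>topspace X. 0 \<le> f x" "\<forall>x\<in>topspace X. 0 < f x \<longleftrightarrow> x \<in> U"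
proof -
  obtain M d where M: "Metric_space M d" and X: "X = Metric_space.mtopology M d"
    using assms(1) by (auto simp: metrizable_space_def)
  interpret Metric_space M d by fact
  show thesis
  proof (cases "M \<subseteq> U")
    case True
    show thesis
      by (rule that[of "\<lambda>_. 1"]) (use True X in auto)
  next
    case False
    define f where "f x = Inf (d x ` (M - U))" for x
    have bdd: "bdd_below (d x ` (M - U))" for x
      by (rule bdd_belowI[of _ 0]) auto
    have ge: "0 \<le> f x" for x
      unfolding f_def using False by (intro cINF_greatest) auto
    have lip: "f x \<le> f y + d x y" if "x \<in> M" "y \<in> M" for x y
    proof -
      have "f x - d x y \<le> d y a" if a: "a \<in> M - U" for a
      proof -
        have "f x \<le> d x a" unfolding f_def using a bdd by (intro cINF_lower) auto
        then show ?thesis using triangle[of x y a] a \<open>x \<in> M\<close> \<open>y \<in> M\<close> by auto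
      qed
      then have "f x - d x y \<le> f y" unfolding f_def[of y] using False by (intro cINF_greatest) auto
      then show ?thesis by simp
    qed
    have lip': "dist (f x) (f y) \<le> d x y" if "x \<in> M" "y \<in> M" for x y
      using lip[OF that] lip[OF that(2,1)] commute[of x y] by (auto simp: dist_real_def)
    have "continuous_map mtopology Met_TC.mtopology f"
      unfolding metric_continuous_map[OF Met_TC.Metric_space_axioms]
      by (auto intro!: exI[of _ e for e] intro: le_less_trans[OF lip'])
    moreover have "0 < f x \<longleftrightarrow> x \<in> U" if "x \<in> M" for x
    proof
      assume "0 < f x"
      show "x \<in> U"
      proof (rule ccontr)
        assume "x \<notin> U"
        then have "f x \<le> d x x" unfolding f_def using that bdd by (intro cINF_lower) auto
        then show False using \<open>0 < f x\<close> that by simp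
      qed
    next
      assume "x \<in> U"
      then obtain r where r: "r > 0" "mball x r \<subseteq> U"
        using assms(2) X openin_mtopology by auto
      have "r \<le> f x"
        unfolding f_def using False r that by (intro cINF_greatest) (auto simp: mball_def subset_iff not_less[symmetric])
      then show "0 < f x" using r by simp
    qed
    ultimately show thesis using X ge by (intro that[of f]) auto
  qed
qed

text \<open>The functions are the barycentric coordinates of a map from \<open>Y\<close> to a
  complex whose simplices have distinctly coloured vertices, hence of dimension at most
  \<open>m\<close>.\<close>

definition coloured_partition ::
  "'a topology \<Rightarrow> nat \<Rightarrow> ('i \<Rightarrow> nat) \<Rightarrow> 'i set \<Rightarrow> ('i \<Rightarrow> 'a \<Rightarrow> real) \<Rightarrow> bool" where
  "coloured_partition Y m c I g \<longleftrightarrow> finite I \<and> (\<forall>s\<in>I. c s \<le> m) \<and>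
     (\<forall>s\<in>I. continuous_map Y euclideanreal (g s)) \<and>
     (\<forall>s\<in>I. \<forall>y\<in>topspace Y. 0 \<le> g s y) \<and> (\<forall>y\<in>topspace Y. (\<Sum>s\<in>I. g s y) = 1) \<and>
     (\<forall>s\<in>I. \<forall>t\<in>I. \<forall>y\<in>topspace Y. c s = c t \<longrightarrow> 0 < g s y \<longrightarrow> 0 < g t y \<longrightarrow> s = t)"

text \<open>The barycentric subdivision of the nerve of a cover of order \<open>m + 1\<close>: its vertices are the
  nonempty sets of members of the cover, coloured by dimension.\<close>

lemma coloured_partition_exists:
  assumes X: "metrizable_space X" and dim: "cover_dim_le X m" and U: "fin_open_cover X \<U>"
  obtains I and g :: "'a set set \<Rightarrow> 'a \<Rightarrow> real"
  where "coloured_partition X m (\<lambda>S. card S - 1) I g"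
    "\<forall>S\<in>I. \<exists>U\<in>\<U>. {x\<in>topspace X. 0 < g S x} \<subseteq> U"
proof -
  obtain \<V> where V: "fin_open_cover X \<V>" "\<forall>V\<in>\<V>. \<exists>U\<in>\<U>. V \<subseteq> U"
    "\<forall>x\<in>topspace X. card {V\<in>\<V>. x \<in> V} \<le> Suc m"
    using dim U unfolding cover_dim_le_def by metis
  have fin: "finite \<V>" using V(1) by (simp add: fin_open_cover_def)
  have "\<exists>f. continuous_map X euclideanreal f \<and> (\<forall>x\<in>topspace X. 0 \<le> f x) \<and>
      (\<forall>x\<in>topspace X. 0 < f x \<longleftrightarrow> x \<in> V)" if "V \<in> \<V>" for V
    using metrizable_cozero[OF X, of V] V(1) that by (metis fin_open_cover_def)
  then obtain l where l: "\<And>V. V \<in> \<V> \<Longrightarrow> continuous_map X euclideanreal (l V)"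
      "\<And>V x. V \<in> \<V> \<Longrightarrow> x \<in> topspace X \<Longrightarrow> 0 \<le> l V x"
      "\<And>V x. V \<in> \<V> \<Longrightarrow> x \<in> topspace X \<Longrightarrow> 0 < l V x \<longleftrightarrow> x \<in> V"
    by metis
  \<comment> \<open>\<open>h S\<close> is positive exactly where each function of \<open>S\<close>
    is positive and exceeds each function outside \<open>S\<close>, which is the open star of the
    barycentre of \<open>S\<close>. Two such sets at the same point are nested, so equal cardinality
    makes them equal.\<close>
  define h where "h S x = (\<Prod>V\<in>S. l V x * (\<Prod>V'\<in>\<V> - S. max 0 (l V x - l V' x)))" for S x
  define I where "I = {S. S \<subseteq> \<V> \<and> S \<noteq> {} \<and> card S \<le> Suc m}"
  have finI: "finite I" unfolding I_def by (rule finite_subset[of _ "Pow \<V>"]) (use fin in auto)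
  have h_cont: "continuous_map X euclideanreal (h S)" if "S \<in> I" for S
    unfolding h_def
    by (intro continuous_intros l) (use that fin in \<open>auto simp: I_def intro: finite_subset\<close>)
  have h_ge: "0 \<le> h S x" if "S \<in> I" "x \<in> topspace X" for S x
    unfolding h_def by (intro prod_nonneg mult_nonneg_nonneg) (use that l(2) in \<open>auto simp: I_def intro!: prod_nonneg\<close>)
  have h_pos: "0 < h S x \<longleftrightarrow> (\<forall>V\<in>S. x \<in> V \<and> (\<forall>V'\<in>\<V> - S. l V' x < l V x))"
    if S: "S \<in> I" and x: "x \<in> topspace X" for S x
  proof
    assume h: "0 < h S x"
    have "finite S" using S fin by (auto simp: I_def intro: finite_subset)
    then have "l V x * (\<Prod>V'\<in>\<V> - S. max 0 (l V x - l V' x)) \<noteq> 0" if "V \<in> S" for V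
      using h that unfolding h_def by (metis (no_types, lifting) less_irrefl prod_zero_iff)
    then have *: "l V x \<noteq> 0" "\<forall>V'\<in>\<V> - S. max 0 (l V x - l V' x) \<noteq> 0" if "V \<in> S" for V
      using that fin by auto
    show "\<forall>V\<in>S. x \<in> V \<and> (\<forall>V'\<in>\<V> - S. l V' x < l V x)"
    proof (intro ballI conjI)
      fix V assume V: "V \<in> S"
      then have "0 < l V x" using *(1)[OF V] l(2)[of V x] S x by (auto simp: I_def less_le)
      then show "x \<in> V" using l(3)[of V x] V S x by (auto simp: I_def)
      show "l V' x < l V x" if "V' \<in> \<V> - S" for V'
        using *(2)[OF V, rule_format, OF that] by (simp add: max_def split: if_splits)
    qed
  next
    assume R: "\<forall>V\<in>S. x \<in> V \<and> (\<forall>V'\<in>\<V> - S. l V' x < l V x)"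
    show "0 < h S x"
      unfolding h_def
    proof (intro prod_pos mult_pos_pos)
      fix V assume "V \<in> S"
      then show "0 < l V x" using R S x l(3)[of V x] by (auto simp: I_def)
      show "0 < max 0 (l V x - l V' x)" if "V' \<in> \<V> - S" for V'
        using R \<open>V \<in> S\<close> that by (simp add: less_max_iff_disj)
    qed
  qed
  have tot: "0 < (\<Sum>S\<in>I. h S x)" if x: "x \<in> topspace X" for x
  proof -
    \<comment> \<open>The members at which the maximum is attained form a set with positive
      \<open>h\<close>. The maximum is positive, so these members all contain \<open>x\<close>, and
      the order of the cover bounds their number.\<close>
    define \<mu> where "\<mu> = Max ((\<lambda>V. l V x) ` \<V>)"
    define S where "S = {V\<in>\<V>. l V x = \<mu>}"
    obtain V where V': "V \<in> \<V>" "x \<in> V" using x V(1) unfolding fin_open_cover_def by blast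
    have "\<mu> \<in> (\<lambda>V. l V x) ` \<V>" unfolding \<mu>_def using fin V' by (intro Max_in) auto
    then have "S \<noteq> {}" by (auto simp: S_def)
    have le: "l W x \<le> \<mu>" if "W \<in> \<V>" for W unfolding \<mu>_def using fin that by (intro Max_ge) auto
    have "0 < \<mu>" using le[OF V'(1)] l(3)[OF V'(1) x] V'(2) by auto
    then have S_mem: "x \<in> W" if "W \<in> S" for W using that l(3)[of W x] x by (auto simp: S_def)
    then have "card S \<le> card {V\<in>\<V>. x \<in> V}" using fin by (intro card_mono) (auto simp: S_def)
    then have SI: "S \<in> I" using V(3) x \<open>S \<noteq> {}\<close> by (auto simp: I_def S_def)
    have "l W x < \<mu>" if "W \<in> \<V> - S" for W using le[of W] that by (auto simp: S_def less_le)
    then have "0 < h S x" unfolding h_pos[OF SI x] using S_mem by (auto simp: S_def)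
    then show ?thesis using h_ge x SI finI by (intro sum_pos2[of I S]) auto
  qed
  define g where "g S x = h S x / (\<Sum>S\<in>I. h S x)" for S x
  have g_pos: "0 < g S x \<longleftrightarrow> 0 < h S x" if "x \<in> topspace X" for S x
    using tot[OF that] by (auto simp: g_def zero_less_divide_iff)
  have uniq: "S = T" if S: "S \<in> I" "T \<in> I" and x: "x \<in> topspace X"
    and c: "card S - 1 = card T - 1" and pos: "0 < g S x" "0 < g T x" for S T x
  proof (rule ccontr)
    assume "S \<noteq> T"
    have fST: "finite S" "finite T" "S \<subseteq> \<V>" "T \<subseteq> \<V>" using S fin by (auto simp: I_def intro: finite_subset)
    then have "card S > 0" "card T > 0" using S by (auto simp: I_def card_gt_0_iff)
    then have "card S = card T" using c by linarith
    then have "\<not> S \<subseteq> T" "\<not> T \<subseteq> S" using \<open>S \<noteq> T\<close> card_subset_eq fST by metis+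
    then obtain V V' where V: "V \<in> S" "V \<in> \<V> - T" "V' \<in> T" "V' \<in> \<V> - S" using fST by blast
    have "l V' x < l V x" using h_pos[OF S(1) x] pos(1) g_pos[OF x] V by auto
    moreover have "l V x < l V' x" using h_pos[OF S(2) x] pos(2) g_pos[OF x] V by auto
    ultimately show False by simp
  qed
  show thesis
  proof
    show "coloured_partition X m (\<lambda>S. card S - 1) I g"
      unfolding coloured_partition_def
    proof (intro conjI ballI impI finI)
      fix S assume S: "S \<in> I"
      show "card S - 1 \<le> m" using S by (auto simp: I_def)
      show "continuous_map X euclideanreal (g S)"
        unfolding g_def by (intro continuous_intros h_cont S finI) (use tot in force)+
      show "0 \<le> g S x" if "x \<in> topspace X" for x
        unfolding g_def using h_ge[OF S that] tot[OF that] by simp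
    next
      show "(\<Sum>S\<in>I. g S x) = 1" if "x \<in> topspace X" for x
        unfolding g_def sum_divide_distrib[symmetric] using tot[OF that] by simp
    qed (rule uniq)
    show "\<forall>S\<in>I. \<exists>U\<in>\<U>. {x\<in>topspace X. 0 < g S x} \<subseteq> U"
    proof
      fix S assume S: "S \<in> I"
      then obtain V where V': "V \<in> S" "V \<in> \<V>" by (auto simp: I_def)
      then obtain U where "U \<in> \<U>" "V \<subseteq> U" using V(2) by blast
      then show "\<exists>U\<in>\<U>. {x\<in>topspace X. 0 < g S x} \<subseteq> U"
        using h_pos[OF S] g_pos V' by blast
    qed
  qed
qed

section \<open>The staircase cover of a product\<close>

lemma openin_Collect_positive:
  fixes f :: "'a \<Rightarrow> real"
  assumes "continuous_map X euclideanreal f"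
  shows "openin X {x\<in>topspace X. 0 < f x}"
  using openin_continuous_map_preimage[OF assms, of "{0<..}"] by simp

lemma openin_Collect_all:
  assumes "finite J" "\<And>i. i \<in> J \<Longrightarrow> openin X {x\<in>topspace X. P i x}"
  shows "openin X {x\<in>topspace X. \<forall>i\<in>J. P i x}"
  using assms
proof (induction J)
  case (insert i J)
  have "{x\<in>topspace X. \<forall>i\<in>insert i J. P i x} = {x\<in>topspace X. P i x} \<inter> {x\<in>topspace X. \<forall>i\<in>J. P i x}"
    by auto
  then show ?case using insert by (auto intro: openin_Int)
qed simp

text \<open>The members of the cover are the open stars of the vertices in the staircase triangulation of a
  product of complexes with coloured vertices: a point of the \<open>i\<close>-th complex cuts the unit interval into
  intervals, one for each colour, and a point of the product lies in the star of \<open>v\<close> iff the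
  intervals of the colours \<open>c (v i)\<close> have a common interior point.\<close>

locale staircase =
  fixes k :: nat and Y :: "nat \<Rightarrow> 'a topology" and m :: "nat \<Rightarrow> nat"
    and c :: "'i \<Rightarrow> nat" and I :: "nat \<Rightarrow> 'i set" and g :: "nat \<Rightarrow> 'i \<Rightarrow> 'a \<Rightarrow> real"
  assumes part: "\<And>i. i < k \<Longrightarrow> coloured_partition (Y i) (m i) c (I i) (g i)"
begin

abbreviation (input) X :: "(nat \<Rightarrow> 'a) topology" where
  "X \<equiv> product_topology Y {..<k}"

text \<open>The left end of the interval of colour \<open>a\<close>; its right end is
  \<open>lower i (Suc a) y\<close>. In \<open>stair\<close> every left end is below every right end,
  which for intervals of the line means a common interior point.\<close>

definition lower :: "nat \<Rightarrow> nat \<Rightarrow> 'a \<Rightarrow> real" where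
  "lower i a y = (\<Sum>s | s \<in> I i \<and> c s < a. g i s y)"

definition stair :: "(nat \<Rightarrow> 'i) \<Rightarrow> (nat \<Rightarrow> 'a) set" where
  "stair v = {y\<in>topspace X. (\<forall>i\<in>{..<k}. 0 < g i (v i) (y i)) \<and>
     (\<forall>i\<in>{..<k}. \<forall>j\<in>{..<k}. lower i (c (v i)) (y i) < lower j (Suc (c (v j))) (y j))}"

definition verts :: "(nat \<Rightarrow> 'i) set" where
  "verts = PiE {..<k} I"

definition grade :: "(nat \<Rightarrow> 'i) \<Rightarrow> nat" where
  "grade v = (\<Sum>i<k. c (v i))"

definition stairs :: "(nat \<Rightarrow> 'a) set set" where
  "stairs = stair ` verts - {{}}"

text \<open>A genuine choice: different vertices, even of different grade, can have the same star as
  a set. The colour of a member of the cover is the grade of the chosen vertex.\<close>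

definition vtx :: "(nat \<Rightarrow> 'a) set \<Rightarrow> nat \<Rightarrow> 'i" where
  "vtx W = (SOME v. v \<in> verts \<and> stair v = W)"

definition col :: "(nat \<Rightarrow> 'a) set \<Rightarrow> nat" where
  "col W = grade (vtx W)"

lemma finite_index: "i < k \<Longrightarrow> finite (I i)"
  and colour_le: "i < k \<Longrightarrow> s \<in> I i \<Longrightarrow> c s \<le> m i"
  and g_cont: "i < k \<Longrightarrow> s \<in> I i \<Longrightarrow> continuous_map (Y i) euclideanreal (g i s)"
  and g_nonneg: "i < k \<Longrightarrow> s \<in> I i \<Longrightarrow> y \<in> topspace (Y i) \<Longrightarrow> 0 \<le> g i s y"
  and g_sum: "i < k \<Longrightarrow> y \<in> topspace (Y i) \<Longrightarrow> (\<Sum>s\<in>I i. g i s y) = 1"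
  and g_unique: "i < k \<Longrightarrow> s \<in> I i \<Longrightarrow> t \<in> I i \<Longrightarrow> y \<in> topspace (Y i) \<Longrightarrow> c s = c t \<Longrightarrow>
    0 < g i s y \<Longrightarrow> 0 < g i t y \<Longrightarrow> s = t"
  using part[of i] unfolding coloured_partition_def by auto

lemma lower_mono:
  assumes "i < k" "y \<in> topspace (Y i)" "a \<le> b"
  shows "lower i a y \<le> lower i b y"
  unfolding lower_def using assms finite_index g_nonneg by (intro sum_mono2) auto

lemma topspaceD: "y \<in> topspace X \<Longrightarrow> i < k \<Longrightarrow> y i \<in> topspace (Y i)"
  by (auto simp: PiE_iff)

lemma vertsD: "v \<in> verts \<Longrightarrow> i < k \<Longrightarrow> v i \<in> I i"
  by (auto simp: verts_def)

lemma g_proj_cont: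
  assumes "i < k" "s \<in> I i"
  shows "continuous_map X euclideanreal (\<lambda>y. g i s (y i))"
  using continuous_map_compose[OF continuous_map_product_projection[of i "{..<k}" Y] g_cont[OF assms]] assms
  by (simp add: o_def)

lemma lower_proj_cont:
  assumes "i < k"
  shows "continuous_map X euclideanreal (\<lambda>y. lower i a (y i))"
  unfolding lower_def using assms finite_index[OF assms] by (intro continuous_map_sum g_proj_cont) auto

lemma openin_stair:
  assumes "v \<in> verts"
  shows "openin X (stair v)"
proof -
  have "openin X {y\<in>topspace X. \<forall>i\<in>{..<k}. 0 < g i (v i) (y i)}"
    using assms by (intro openin_Collect_all openin_Collect_positive g_proj_cont) (auto dest: vertsD)
  moreover have "openin X {y\<in>topspace X. 0 < lower j b (y j) - lower i a (y i)}" if "i < k" "j < k" for i j a b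
    using that by (intro openin_Collect_positive continuous_map_diff lower_proj_cont)
  then have "openin X {y\<in>topspace X. \<forall>i\<in>{..<k}. \<forall>j\<in>{..<k}. lower i (c (v i)) (y i) < lower j (Suc (c (v j))) (y j)}"
    by (intro openin_Collect_all) auto
  ultimately have "openin X ({y\<in>topspace X. \<forall>i\<in>{..<k}. 0 < g i (v i) (y i)} \<inter>
      {y\<in>topspace X. \<forall>i\<in>{..<k}. \<forall>j\<in>{..<k}. lower i (c (v i)) (y i) < lower j (Suc (c (v j))) (y j)})"
    by (rule openin_Int)
  moreover have "stair v = {y\<in>topspace X. \<forall>i\<in>{..<k}. 0 < g i (v i) (y i)} \<inter>
      {y\<in>topspace X. \<forall>i\<in>{..<k}. \<forall>j\<in>{..<k}. lower i (c (v i)) (y i) < lower j (Suc (c (v j))) (y j)}"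
    unfolding stair_def Collect_conj_eq[symmetric] by (rule Collect_cong) argo
  ultimately show ?thesis by simp
qed

text \<open>Intervals near 0: in each coordinate the least colour with a positive function has left
  end 0 and a positive right end.\<close>

lemma stair_covers:
  assumes y: "y \<in> topspace X"
  shows "\<exists>v\<in>verts. y \<in> stair v"
proof -
  have "\<exists>s\<in>I i. 0 < g i s (y i) \<and> (\<forall>t\<in>I i. 0 < g i t (y i) \<longrightarrow> c s \<le> c t)" if i: "i < k" for i
  proof -
    let ?P = "{s\<in>I i. 0 < g i s (y i)}"
    have "?P \<noteq> {}"
    proof
      assume "?P = {}"
      then have "g i s (y i) \<le> 0" if "s \<in> I i" for s using that by (auto simp: not_less)
      then have "(\<Sum>s\<in>I i. g i s (y i)) \<le> 0" by (rule sum_nonpos)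
      then show False using g_sum[OF i topspaceD[OF y i]] by simp
    qed
    then obtain s where "s \<in> ?P" "\<forall>t\<in>?P. c s \<le> c t"
      using ex_has_least_nat[of "\<lambda>s. s \<in> ?P" _ c] by blast
    then show ?thesis by blast
  qed
  then obtain s where s: "\<And>i. i < k \<Longrightarrow> s i \<in> I i" "\<And>i. i < k \<Longrightarrow> 0 < g i (s i) (y i)"
    "\<And>i t. i < k \<Longrightarrow> t \<in> I i \<Longrightarrow> 0 < g i t (y i) \<Longrightarrow> c (s i) \<le> c t"
    by metis
  define v where "v = restrict s {..<k}"
  have v: "v \<in> verts" using s by (auto simp: v_def verts_def)
  have "lower i (c (v i)) (y i) \<le> 0" if i: "i < k" for i
    unfolding lower_def
  proof (rule sum_nonpos)
    fix t assume "t \<in> {t. t \<in> I i \<and> c t < c (v i)}"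
    then show "g i t (y i) \<le> 0" using s(3)[OF i, of t] i by (force simp: v_def)
  qed
  moreover have "0 < lower j (Suc (c (v j))) (y j)" if j: "j < k" for j
    unfolding lower_def
    using j s v finite_index[OF j] g_nonneg[OF j _ topspaceD[OF y j]]
    by (intro sum_pos2[of _ "v j"]) (auto simp: v_def)
  ultimately have "y \<in> stair v"
    unfolding stair_def using y s(2) by (force simp: v_def simp del: topspace_product_topology)
  then show ?thesis using v by blast
qed

text \<open>The intervals of \<open>v\<close> share a point and so do those of \<open>w\<close>.
  Whichever point is further left belongs to colours that are smaller or equal in every coordinate,
  so the two colour vectors are comparable, and equal sums make them equal. Finally, a colour
  determines the positive function of that colour.\<close>

lemma grade_unique:
  assumes v: "v \<in> verts" "y \<in> stair v" and w: "w \<in> verts" "y \<in> stair w" and gr: "grade v = grade w"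
  shows "v = w"
proof -
  have y: "y \<in> topspace X" using v(2) unfolding stair_def by blast
  note yi = topspaceD[OF y]
  have no: False if "y \<in> stair v" "y \<in> stair w" "i < k" "j < k" "c (v i) < c (w i)" "c (w j) < c (v j)" for v w i j
  proof -
    have "lower j (c (v j)) (y j) < lower i (Suc (c (v i))) (y i)"
      using that unfolding stair_def by blast
    also have "\<dots> \<le> lower i (c (w i)) (y i)" using that yi by (intro lower_mono) auto
    also have "\<dots> < lower j (Suc (c (w j))) (y j)" using that unfolding stair_def by blast
    also have "\<dots> \<le> lower j (c (v j)) (y j)" using that yi by (intro lower_mono) auto
    finally show False by simp
  qed
  have "c (v i) = c (w i)" if i: "i < k" for i
  proof (rule ccontr)
    assume ne: "c (v i) \<noteq> c (w i)"
    have gr': "(\<Sum>i<k. c (v i)) = (\<Sum>i<k. c (w i))" using gr by (simp add: grade_def)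
    show False
    proof (cases "c (v i) < c (w i)")
      case True
      have "\<exists>j<k. c (w j) < c (v j)"
      proof (rule ccontr)
        assume "\<not> ?thesis"
        then have "(\<Sum>i<k. c (v i)) < (\<Sum>i<k. c (w i))"
          using i True by (intro sum_strict_mono_ex1) (auto simp: not_less[symmetric])
        then show False using gr' by simp
      qed
      then show False using no[OF v(2) w(2) i _ True] by blast
    next
      case False
      then have lt: "c (w i) < c (v i)" using ne by simp
      have "\<exists>j<k. c (v j) < c (w j)"
      proof (rule ccontr)
        assume "\<not> ?thesis"
        then have "(\<Sum>i<k. c (w i)) < (\<Sum>i<k. c (v i))"
          using i lt by (intro sum_strict_mono_ex1) (auto simp: not_less[symmetric])
        then show False using gr' by simp
      qed
      then show False using no[OF w(2) v(2) i _ lt] by blast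
    qed
  qed
  moreover have "0 < g i (v i) (y i)" "0 < g i (w i) (y i)" if "i < k" for i
    using v(2) w(2) that unfolding stair_def by blast+
  ultimately have "v i = w i" if "i < k" for i
    using g_unique[OF that vertsD[OF v(1) that] vertsD[OF w(1) that] yi[OF that]] that by blast
  then show ?thesis using v(1) w(1) unfolding verts_def by (intro PiE_ext) auto
qed

lemma vtx:
  assumes "W \<in> stairs"
  shows "vtx W \<in> verts \<and> stair (vtx W) = W"
proof -
  have "\<exists>v. v \<in> verts \<and> stair v = W" using assms by (auto simp: stairs_def)
  then show ?thesis unfolding vtx_def by (rule someI_ex)
qed

lemma fin_open_cover_stairs: "fin_open_cover X stairs"
  unfolding fin_open_cover_def
proof (intro conjI ballI)
  have "finite verts" unfolding verts_def using finite_index by (intro finite_PiE) auto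
  then show "finite stairs" by (simp add: stairs_def)
  show "openin X W" if "W \<in> stairs" for W using that openin_stair by (auto simp: stairs_def)
  then have "\<Union>stairs \<subseteq> topspace X" using openin_subset by blast
  moreover have "topspace X \<subseteq> \<Union>stairs" using stair_covers by (fastforce simp: stairs_def simp del: topspace_product_topology)
  ultimately show "\<Union>stairs = topspace X" by (rule antisym)
qed

lemma grade_le: "v \<in> verts \<Longrightarrow> grade v \<le> (\<Sum>i<k. m i)"
  unfolding grade_def using colour_le vertsD by (intro sum_mono) auto

lemma balanced_stairs: "balanced X stairs col (\<Sum>i<k. m i)"
  unfolding balanced_def
proof (intro conjI ballI impI)
  show "col W \<le> (\<Sum>i<k. m i)" if "W \<in> stairs" for W
    using vtx[OF that] grade_le by (simp add: col_def)
  fix A B assume A: "A \<in> stairs" and B: "B \<in> stairs" and "topspace X \<inter> A \<inter> B \<noteq> {}" and "col A = col B"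
  then obtain y where "y \<in> A" "y \<in> B" by (meson IntE all_not_in_conv)
  then have "y \<in> stair (vtx A)" "y \<in> stair (vtx B)" "grade (vtx A) = grade (vtx B)"
    using vtx[OF A] vtx[OF B] \<open>col A = col B\<close> by (simp_all add: col_def)
  then have "vtx A = vtx B" using vtx[OF A] vtx[OF B] grade_unique by blast
  then show "A = B" using vtx[OF A] vtx[OF B] by metis
qed

lemma stairs_refine:
  assumes V: "\<And>i s. i < k \<Longrightarrow> s \<in> I i \<Longrightarrow> \<exists>V\<in>\<V> i. {y\<in>topspace (Y i). 0 < g i s y} \<subseteq> V"
    and U: "\<And>V. (\<And>i. i \<in> {..<k} \<Longrightarrow> V i \<in> \<V> i) \<Longrightarrow> \<exists>U\<in>\<U>. PiE {..<k} V \<subseteq> U"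
    and W: "W \<in> stairs"
  shows "\<exists>U\<in>\<U>. W \<subseteq> U"
proof -
  let ?v = "vtx W"
  have "\<forall>i\<in>{..<k}. \<exists>V\<in>\<V> i. {y\<in>topspace (Y i). 0 < g i (?v i) y} \<subseteq> V"
    using V vertsD vtx[OF W] by blast
  then obtain V where V': "\<And>i. i \<in> {..<k} \<Longrightarrow> V i \<in> \<V> i"
      "\<And>i. i \<in> {..<k} \<Longrightarrow> {y\<in>topspace (Y i). 0 < g i (?v i) y} \<subseteq> V i" by metis
  have "stair ?v \<subseteq> PiE {..<k} V"
  proof
    fix y assume "y \<in> stair ?v"
    then have "y \<in> PiE {..<k} (\<lambda>i. topspace (Y i))" "\<forall>i\<in>{..<k}. 0 < g i (?v i) (y i)"
      by (auto simp: stair_def)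
    then show "y \<in> PiE {..<k} V" using V'(2) by (auto simp: PiE_iff)
  qed
  then show ?thesis using U[OF V'(1)] vtx[OF W] by (metis subset_trans)
qed

end

section \<open>Maps to products of spheres\<close>

text \<open>The indices are the vertices of the boundary of the cross-polytope:
  \<open>(j, True)\<close> and \<open>(j, False)\<close> are the two unit vectors on axis
  \<open>j\<close>, both of colour \<open>j\<close>.\<close>

definition sphere_part :: "nat \<times> bool \<Rightarrow> (nat \<Rightarrow> real) \<Rightarrow> real" where
  "sphere_part t x = (max 0 (if snd t then x (fst t) else - x (fst t)))\<^sup>2"

lemma sphere_part_sum: "sphere_part (j, False) x + sphere_part (j, True) x = (x j)\<^sup>2"
  by (auto simp: sphere_part_def max_def)

lemma sphere_part_pos: "0 < sphere_part t x \<longleftrightarrow> 0 < (if snd t then x (fst t) else - x (fst t))"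
  by (auto simp: sphere_part_def max_def)

lemma sum_sphere_part:
  assumes "finite J"
  shows "(\<Sum>t\<in>J \<times> UNIV. sphere_part t x) = (\<Sum>j\<in>J. (x j)\<^sup>2)"
proof -
  have "(\<Sum>t\<in>J \<times> UNIV. sphere_part t x) = (\<Sum>j\<in>J. \<Sum>b\<in>UNIV. sphere_part (j, b) x)"
    by (simp add: sum.cartesian_product)
  also have "\<dots> = (\<Sum>j\<in>J. (x j)\<^sup>2)"
    by (simp add: UNIV_bool sphere_part_sum)
  finally show ?thesis .
qed

lemma coloured_partition_sphere:
  "coloured_partition (sphere_top m) m fst ({..m} \<times> UNIV) sphere_part"
  unfolding coloured_partition_def
proof (intro conjI ballI impI)
  fix t assume t: "t \<in> {..m} \<times> (UNIV :: bool set)"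
  then show "fst t \<le> m" by auto
  have "continuous_map (sphere_top m) euclideanreal (\<lambda>x. x (fst t))"
    unfolding sphere_top_def using t
    by (intro continuous_map_from_subtopology continuous_map_product_projection) auto
  then show "continuous_map (sphere_top m) euclideanreal (sphere_part t)"
    unfolding sphere_part_def by (cases "snd t") (auto intro!: continuous_intros)
  show "0 \<le> sphere_part t y" for y by (simp add: sphere_part_def)
  show "t = u" if "fst t = fst u" "0 < sphere_part t y" "0 < sphere_part u y" for u y
    using that by (cases t; cases u) (auto simp: sphere_part_pos split: if_splits)
next
  show "(\<Sum>t\<in>{..m} \<times> UNIV. sphere_part t y) = 1" if "y \<in> topspace (sphere_top m)" for y
    using that by (simp add: sum_sphere_part sphere_top_def)
qed simp

text \<open>At each point at most one term of each sum is nonzero. The sum thus selects the positive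
  function of colour \<open>j\<close>, in a form that is visibly continuous.\<close>

definition signed_sqrt_map ::
  "nat \<Rightarrow> ('i \<Rightarrow> nat) \<Rightarrow> 'i set \<Rightarrow> ('i \<Rightarrow> 'a \<Rightarrow> real) \<Rightarrow> ('i \<Rightarrow> bool) \<Rightarrow> 'a \<Rightarrow> nat \<Rightarrow> real" where
  "signed_sqrt_map m c I g \<epsilon> y =
    (\<lambda>j\<in>{..m}. \<Sum>s | s \<in> I \<and> c s = j. (if \<epsilon> s then 1 else -1) * sqrt (g s y))"

context
  fixes Y :: "'a topology" and m :: nat and c :: "'i \<Rightarrow> nat" and I :: "'i set"
    and g :: "'i \<Rightarrow> 'a \<Rightarrow> real" and \<epsilon> :: "'i \<Rightarrow> bool"
  assumes part: "coloured_partition Y m c I g"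
begin

abbreviation (input) "ssm \<equiv> signed_sqrt_map m c I g \<epsilon>"

lemma signed_sqrt_map_eq:
  assumes y: "y \<in> topspace Y" and s: "s \<in> I" "0 < g s y"
  shows "ssm y (c s) = (if \<epsilon> s then 1 else -1) * sqrt (g s y)"
    and "(\<Sum>t | t \<in> I \<and> c t = c s. g t y) = g s y"
proof -
  have z: "g t y = 0" if "t \<in> I" "c t = c s" "t \<noteq> s" for t
    using part y s that unfolding coloured_partition_def by (metis less_le)
  have fin: "finite {t. t \<in> I \<and> c t = c s}" and le: "c s \<le> m"
    using part s by (auto simp: coloured_partition_def)
  have "(\<Sum>t | t \<in> I \<and> c t = c s. (if \<epsilon> t then 1 else -1) * sqrt (g t y)) =
      (\<Sum>t\<in>{s}. (if \<epsilon> t then 1 else -1) * sqrt (g t y))"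
    by (rule sum.mono_neutral_right) (use fin s z in auto)
  then show "ssm y (c s) = (if \<epsilon> s then 1 else -1) * sqrt (g s y)"
    using le by (simp add: signed_sqrt_map_def)
  have "(\<Sum>t | t \<in> I \<and> c t = c s. g t y) = (\<Sum>t\<in>{s}. g t y)"
    by (rule sum.mono_neutral_right) (use fin s z in auto)
  then show "(\<Sum>t | t \<in> I \<and> c t = c s. g t y) = g s y" by simp
qed

lemma signed_sqrt_map_square:
  assumes y: "y \<in> topspace Y" and j: "j \<le> m"
  shows "(ssm y j)\<^sup>2 = (\<Sum>s | s \<in> I \<and> c s = j. g s y)"
proof (cases "\<exists>s\<in>I. c s = j \<and> 0 < g s y")
  case True
  then obtain s where "s \<in> I" "c s = j" "0 < g s y" by blast
  then show ?thesis
    using signed_sqrt_map_eq[OF y, of s] by (auto simp: power_mult_distrib)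
next
  case False
  then have "g s y = 0" if "s \<in> I" "c s = j" for s
    using that part y unfolding coloured_partition_def by (metis less_le)
  then show ?thesis using j by (simp add: signed_sqrt_map_def)
qed

text \<open>Squaring a coordinate forgets the sign and recovers the positive function of that
  colour. So a point and its image have the same colour intervals, whatever
  \<open>\<epsilon>\<close> is; this is why the map respects the staircases.\<close>

lemma sum_signed_sqrt_map:
  assumes y: "y \<in> topspace Y"
  shows "(\<Sum>t | t \<in> {..m} \<times> UNIV \<and> fst t < a. sphere_part t (ssm y)) = (\<Sum>s | s \<in> I \<and> c s < a. g s y)"
proof -
  have fin: "finite I" and le: "\<And>s. s \<in> I \<Longrightarrow> c s \<le> m"
    using part by (auto simp: coloured_partition_def)
  have "{t. t \<in> {..m} \<times> (UNIV :: bool set) \<and> fst t < a} = {j. j \<le> m \<and> j < a} \<times> UNIV" by auto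
  then have "(\<Sum>t | t \<in> {..m} \<times> UNIV \<and> fst t < a. sphere_part t (ssm y)) =
      (\<Sum>j | j \<le> m \<and> j < a. (ssm y j)\<^sup>2)"
    by (simp add: sum_sphere_part)
  also have "\<dots> = (\<Sum>j | j \<le> m \<and> j < a. \<Sum>s | s \<in> {s\<in>I. c s < a} \<and> c s = j. g s y)"
  proof (intro sum.cong refl)
    fix j assume "j \<in> {j. j \<le> m \<and> j < a}"
    moreover from this have "{s. s \<in> {s\<in>I. c s < a} \<and> c s = j} = {s. s \<in> I \<and> c s = j}" by auto
    ultimately show "(ssm y j)\<^sup>2 = (\<Sum>s | s \<in> {s\<in>I. c s < a} \<and> c s = j. g s y)"
      using signed_sqrt_map_square[OF y, of j] by simp
  qed
  also have "\<dots> = (\<Sum>s\<in>{s\<in>I. c s < a}. g s y)"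
    by (rule sum.group) (use fin le in auto)
  finally show ?thesis by simp
qed

lemma continuous_signed_sqrt_map: "continuous_map Y (sphere_top m) ssm"
  unfolding sphere_top_def continuous_map_in_subtopology continuous_map_componentwise
proof (intro conjI ballI)
  have fin: "finite I"
    using part by (auto simp: coloured_partition_def)
  show "ssm ` topspace Y \<subseteq> extensional {..m}" by (auto simp: signed_sqrt_map_def)
  fix j assume "j \<in> {..m}"
  then have eq: "(\<lambda>y. ssm y j) = (\<lambda>y. \<Sum>s | s \<in> I \<and> c s = j. (if \<epsilon> s then 1 else -1) * sqrt (g s y))"
    by (simp add: signed_sqrt_map_def)
  show "continuous_map Y euclideanreal (\<lambda>y. ssm y j)"
    unfolding eq
  proof (rule continuous_map_sum)
    fix s assume "s \<in> {s. s \<in> I \<and> c s = j}"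
    then have "continuous_map Y euclideanreal (g s)" using part by (simp add: coloured_partition_def)
    moreover have "continuous_map euclideanreal euclideanreal sqrt" by (simp add: continuous_intros)
    ultimately have "continuous_map Y euclideanreal (\<lambda>y. sqrt (g s y))"
      using continuous_map_compose[of Y euclideanreal "g s" euclideanreal sqrt] by (simp add: o_def)
    then show "continuous_map Y euclideanreal (\<lambda>y. (if \<epsilon> s then 1 else -1) * sqrt (g s y))"
      by (rule continuous_map_real_mult_left)
  qed (use fin in simp)
next
  have "(\<Sum>j\<le>m. (ssm y j)\<^sup>2) = 1" if y: "y \<in> topspace Y" for y
  proof -
    have "{t. t \<in> {..m} \<times> (UNIV :: bool set) \<and> fst t < Suc m} = {..m} \<times> UNIV" by auto
    moreover have "{s. s \<in> I \<and> c s < Suc m} = I"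
      using part by (auto simp: coloured_partition_def less_Suc_eq_le)
    ultimately have "(\<Sum>j\<le>m. (ssm y j)\<^sup>2) = (\<Sum>s\<in>I. g s y)"
      using sum_signed_sqrt_map[OF y, of "Suc m"] sum_sphere_part[of "{..m}"] by simp
    then show ?thesis using part y by (simp add: coloured_partition_def)
  qed
  then show "ssm \<in> topspace Y \<rightarrow> {x. (\<Sum>j\<le>m. (x j)\<^sup>2) = 1}" by auto
qed

end

interpretation sphere_stairs: staircase k "\<lambda>i. sphere_top (nd i)" nd fst "\<lambda>i. {..nd i} \<times> UNIV" "\<lambda>_. sphere_part"
  for k nd
  by unfold_locales (rule coloured_partition_sphere)

context
  fixes k :: nat and nd :: "nat \<Rightarrow> nat"
begin

abbreviation (input) "sverts \<equiv> sphere_stairs.verts k nd"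
abbreviation (input) "sstair \<equiv> sphere_stairs.stair k nd"

text \<open>The witness is the vertex \<open>v\<close> itself, realised as a tuple of signed unit vectors.\<close>

lemma sphere_stair_inj:
  assumes v: "v \<in> sverts"
  shows "sstair v \<noteq> {}" and "w \<in> sverts \<Longrightarrow> sstair v = sstair w \<Longrightarrow> v = w"
proof -
  define e where "e i = (\<lambda>j\<in>{..nd i}. if j = fst (v i) then if snd (v i) then 1 else -1 else 0 :: real)" for i
  define x where "x = restrict e {..<k}"
  have vi: "fst (v i) \<le> nd i" if "i < k" for i
    using sphere_stairs.vertsD[OF v that] by auto
  have e_pos: "0 < sphere_part t (e i) \<longleftrightarrow> t = v i" if "i < k" "fst t \<le> nd i" for t i
    using vi[OF that(1)] that(2) by (cases t; cases "v i") (auto simp: sphere_part_pos e_def)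
  have e_top: "e i \<in> topspace (sphere_top (nd i))" if "i < k" for i
  proof -
    have "(\<Sum>j\<le>nd i. (e i j)\<^sup>2) = (\<Sum>j\<le>nd i. if j = fst (v i) then 1 else 0)"
      by (intro sum.cong) (auto simp: e_def)
    then show ?thesis using vi[OF that] by (simp add: sphere_top_def e_def)
  qed
  have low: "sphere_stairs.lower nd i (fst (v i)) (e i) \<le> 0" if "i < k" for i
    unfolding sphere_stairs.lower_def
  proof (rule sum_nonpos)
    fix t :: "nat \<times> bool" assume t: "t \<in> {t \<in> {..nd i} \<times> UNIV. fst t < fst (v i)}"
    then have "\<not> 0 < sphere_part t (e i)" using e_pos[OF that, of t] by auto
    then show "sphere_part t (e i) \<le> 0" by simp
  qed
  have up: "0 < sphere_stairs.lower nd i (Suc (fst (v i))) (e i)" if "i < k" for i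
    unfolding sphere_stairs.lower_def
  proof (rule sum_pos2[of _ "v i"])
    show "v i \<in> {s \<in> {..nd i} \<times> UNIV. fst s < Suc (fst (v i))}"
      using sphere_stairs.vertsD[OF v that] by auto
    show "0 < sphere_part (v i) (e i)" using e_pos[OF that vi[OF that]] by simp
    show "0 \<le> sphere_part t (e i)" for t by (simp add: sphere_part_def)
    show "finite {s \<in> {..nd i} \<times> (UNIV :: bool set). fst s < Suc (fst (v i))}" by simp
  qed
  have x: "x \<in> sstair v"
    unfolding sphere_stairs.stair_def
    using e_pos[OF _ vi] e_top le_less_trans[OF low up] by (auto simp: x_def)
  then show "sstair v \<noteq> {}" by blast
  assume w: "w \<in> sverts" and eq: "sstair v = sstair w"
  have "v i = w i" if "i < k" for i
  proof -
    have "x \<in> sstair w" using x eq by simp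
    then have "0 < sphere_part (w i) (x i)" using that by (auto simp: sphere_stairs.stair_def)
    moreover have "fst (w i) \<le> nd i" using sphere_stairs.vertsD[OF w that] by auto
    ultimately show ?thesis using e_pos[OF that] that by (simp add: x_def)
  qed
  then show "v = w" using v w unfolding sphere_stairs.verts_def by (intro PiE_ext) auto
qed

text \<open>On the spheres the star determines its vertex, so the colour of a star is the grade of
  the vertex from which it was built.\<close>

lemma sphere_vtx_stair: "v \<in> sverts \<Longrightarrow> sphere_stairs.vtx k nd (sstair v) = v"
  using sphere_stair_inj sphere_stairs.vtx[of "sstair v" k nd] by (auto simp: sphere_stairs.stairs_def)

end

lemma map_eq_imp_eq:
  assumes "\<And>a b. a \<in> set xs \<Longrightarrow> b \<in> set ys \<Longrightarrow> f a = f b \<Longrightarrow> a = b" "map f xs = map f ys"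
  shows "xs = ys"
proof (rule nth_equalityI)
  show len: "length xs = length ys" using assms(2) map_eq_imp_length_eq by blast
  show "xs ! i = ys ! i" if "i < length xs" for i
    using assms(1)[of "xs ! i" "ys ! i"] assms(2) that len by (metis nth_map nth_mem)
qed

lemma (in staircase) elementary_class_in_sphere_image:
  fixes G :: "('g, 'm) monoid_scheme"
  assumes G: "comm_group G" and n: "(\<Sum>i<k. m i) = Suc n"
    and \<gamma>: "\<gamma> \<in> nerve_tuples X stairs (Suc n)" and a: "a \<in> carrier G"
  obtains \<phi> where "\<forall>i<k. continuous_map (Y i) (sphere_top (m i)) (\<phi> i)"
    "cech_class X G (Suc n) (stairs, comm_group.elementary G X stairs col (Suc n) \<gamma> a)
      \<in> cech_hom X (product_topology (\<lambda>i. sphere_top (m i)) {..<k}) G (Suc n)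
          (\<lambda>y. \<lambda>i\<in>{..<k}. \<phi> i (y i)) `
        carrier (cech_group (product_topology (\<lambda>i. sphere_top (m i)) {..<k}) G (Suc n))"
proof -
  interpret G: comm_group G by fact
  let ?Z = "product_topology (\<lambda>i. sphere_top (m i)) {..<k}"
  obtain y0 where y0: "y0 \<in> topspace X" "\<And>W. W \<in> set \<gamma> \<Longrightarrow> y0 \<in> W" and \<gamma>W: "set \<gamma> \<subseteq> stairs"
    using \<gamma> unfolding nerve_tuples_def by blast
  \<comment> \<open>At \<open>y0 i\<close> at most one function of each colour is positive, so a
    vertex with positive sign is determined by its colour. All coordinates of the vertices of
    \<open>\<gamma>\<close> have positive sign, hence nothing else folds onto them.\<close>
  define \<epsilon> where "\<epsilon> i s \<longleftrightarrow> 0 < g i s (y0 i)" for i s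
  define \<phi> where "\<phi> i = signed_sqrt_map (m i) c (I i) (g i) (\<epsilon> i)" for i
  define f where "f = (\<lambda>y. \<lambda>i\<in>{..<k}. \<phi> i (y i))"
  define q where "q v = (\<lambda>i\<in>{..<k}. (c (v i), \<epsilon> i (v i)))" for v
  define p where "p W = sphere_stairs.stair k m (q (vtx W))" for W
  have \<phi>: "continuous_map (Y i) (sphere_top (m i)) (\<phi> i)" if "i < k" for i
    unfolding \<phi>_def by (rule continuous_signed_sqrt_map[OF part[OF that]])
  have f: "continuous_map X ?Z f"
    unfolding f_def
  proof (subst continuous_map_componentwise, intro conjI ballI)
    show "(\<lambda>y. \<lambda>i\<in>{..<k}. \<phi> i (y i)) ` topspace X \<subseteq> extensional {..<k}" by auto
    fix i assume i: "i \<in> {..<k}"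
    then show "continuous_map X (sphere_top (m i)) (\<lambda>y. (\<lambda>i\<in>{..<k}. \<phi> i (y i)) i)"
      using continuous_map_compose[OF continuous_map_product_projection[of i "{..<k}" Y] \<phi>[of i]]
      by (simp add: o_def)
  qed
  have qv: "q v \<in> sphere_stairs.verts k m" if "v \<in> verts" for v
    using vertsD[OF that] colour_le by (auto simp: q_def sphere_stairs.verts_def)
  have f_stair: "f y \<in> sphere_stairs.stair k m (q v)" if v: "v \<in> verts" and y: "y \<in> stair v" for v y
  proof -
    have yX: "y \<in> topspace X" using y unfolding stair_def by blast
    have low: "sphere_stairs.lower m i b (\<phi> i (y i)) = lower i b (y i)" if "i < k" for i b
      unfolding sphere_stairs.lower_def lower_def \<phi>_def
      using sum_signed_sqrt_map[OF part[OF that] topspaceD[OF yX that]] by simp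
    have pos: "0 < sphere_part (c (v i), \<epsilon> i (v i)) (\<phi> i (y i))" if i: "i < k" for i
    proof -
      have "0 < g i (v i) (y i)" using y i by (auto simp: stair_def)
      then show ?thesis
        using signed_sqrt_map_eq(1)[OF part[OF i] topspaceD[OF yX i] vertsD[OF v i], of "\<epsilon> i"]
        by (auto simp: sphere_part_pos \<phi>_def)
    qed
    have "lower i (c (v i)) (y i) < lower j (Suc (c (v j))) (y j)" if "i < k" "j < k" for i j
      using y that by (auto simp: stair_def)
    moreover have "f y \<in> topspace ?Z" using f yX unfolding continuous_map_def by blast
    ultimately show ?thesis
      unfolding sphere_stairs.stair_def using low pos by (simp add: f_def q_def del: topspace_product_topology)
  qed
  have p_al: "along X f stairs (sphere_stairs.stairs k m) p"
    unfolding along_def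
  proof (intro ballI conjI)
    fix W assume "W \<in> stairs"
    then have W: "vtx W \<in> verts" "stair (vtx W) = W" using vtx by auto
    then show "p W \<in> sphere_stairs.stairs k m"
      using qv sphere_stair_inj(1)[OF qv] by (auto simp: p_def sphere_stairs.stairs_def)
    show "f ` (W \<inter> topspace X) \<subseteq> p W" using f_stair[OF W(1)] W(2) by (auto simp: p_def)
  qed
  have p_col: "sphere_stairs.col k m (p W) = col W" if "W \<in> stairs" for W
    using sphere_vtx_stair[OF qv] vtx[OF that]
    by (simp add: p_def col_def sphere_stairs.col_def sphere_stairs.grade_def grade_def q_def)
  have p_inj: "A = B" if A: "A \<in> stairs" and B: "B \<in> set \<gamma>" and eq: "p A = p B" for A B
  proof -
    have vA: "vtx A \<in> verts" "stair (vtx A) = A" and vB: "vtx B \<in> verts" "stair (vtx B) = B"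
      using vtx A B \<gamma>W by auto
    have "q (vtx A) = q (vtx B)"
      using sphere_stair_inj(2)[OF qv[OF vA(1)] qv[OF vB(1)]] eq by (simp add: p_def)
    have "vtx A i = vtx B i" if i: "i < k" for i
    proof -
      have "q (vtx A) i = q (vtx B) i" using \<open>q (vtx A) = q (vtx B)\<close> by simp
      then have eq: "c (vtx A i) = c (vtx B i)" "0 < g i (vtx A i) (y0 i) \<longleftrightarrow> 0 < g i (vtx B i) (y0 i)"
        using i by (auto simp: q_def \<epsilon>_def)
      have "y0 \<in> stair (vtx B)" using y0(2)[OF B] vB(2) by simp
      then have "0 < g i (vtx B i) (y0 i)" using i by (auto simp: stair_def)
      then show ?thesis
        using g_unique[OF i vertsD[OF vA(1) i] vertsD[OF vB(1) i] topspaceD[OF y0(1) i]] eq by blast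
    qed
    then have "vtx A = vtx B" using vA(1) vB(1) unfolding verts_def by (intro PiE_ext) auto
    then show "A = B" using vA vB by metis
  qed
  have "cech_class X G (Suc n) (stairs, G.elementary X stairs col (Suc n) \<gamma> a)
    \<in> cech_hom X ?Z G (Suc n) f ` carrier (cech_group ?Z G (Suc n))"
  proof (rule G.elementary_class_in_image[OF f fin_open_cover_stairs sphere_stairs.fin_open_cover_stairs _ p_al])
    show "sphere_stairs.col k m (p W) = col W" if "W \<in> stairs" for W using that by (rule p_col)
    show "a \<in> carrier G" by (rule a)
    show "balanced ?Z (sphere_stairs.stairs k m) (sphere_stairs.col k m) (Suc n)"
      using sphere_stairs.balanced_stairs[of m k] n by simp
    show "s = \<gamma>" if "set s \<subseteq> stairs" "map p s = map p \<gamma>" for s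
      by (rule map_eq_imp_eq[of _ _ p]) (use that p_inj in auto)
  qed
  then show thesis using that[of \<phi>] \<phi> unfolding f_def by blast
qed

theorem mainTheorem2:
  fixes Y :: "nat \<Rightarrow> 'a topology" and k :: nat and nd :: "nat \<Rightarrow> nat"
    and G :: "('g, 'm) monoid_scheme"
    
  assumes "k \<ge> 1"
    and "\<And>i. i < k \<Longrightarrow> compact_space (Y i) \<and> metrizable_space (Y i)"
    and "\<And>i. i < k \<Longrightarrow> cover_dim_eq (Y i) (nd i) \<and> nd i \<ge> 1"
    and "comm_group G"
    and "subgroup H (cech_group (product_topology Y {..<k}) G (\<Sum>i<k. nd i))"
    and "H \<noteq> carrier (cech_group (product_topology Y {..<k}) G (\<Sum>i<k. nd i))"
  shows "\<exists>\<phi> :: nat \<Rightarrow> 'a \<Rightarrow> (nat \<Rightarrow> real).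
           (\<forall>i<k. continuous_map (Y i) (sphere_top (nd i)) (\<phi> i)) \<and>
           \<not> (cech_hom (product_topology Y {..<k})
                        (product_topology (\<lambda>i. sphere_top (nd i)) {..<k}) G (\<Sum>i<k. nd i)
                        (\<lambda>y. \<lambda>i\<in>{..<k}. \<phi> i (y i))
                 ` carrier (cech_group (product_topology (\<lambda>i. sphere_top (nd i)) {..<k})
                                       G (\<Sum>i<k. nd i))
               \<subseteq> H)"
proof -
  interpret G: comm_group G by fact
  let ?X = "product_topology Y {..<k}" and ?Z = "product_topology (\<lambda>i. sphere_top (nd i)) {..<k}"
  \<comment> \<open>A single factor of positive dimension makes the total degree a successor, as the
    results on the Cech group require.\<close>
  have "nd 0 \<le> (\<Sum>i<k. nd i)" using assms(1) by (intro member_le_sum) auto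
  then obtain n where n: "(\<Sum>i<k. nd i) = Suc n"
    using assms(3)[of 0] assms(1) by (cases "\<Sum>i<k. nd i") auto
  note H = assms(5)[unfolded n]
  obtain A where A: "A \<in> carrier (cech_group ?X G (Suc n))" "A \<notin> H"
    using assms(6) subgroup.subset[OF H] n by auto
  then obtain \<U> z where Uz: "(\<U>, z) \<in> cech_reps ?X G (Suc n)" "A = cech_class ?X G (Suc n) (\<U>, z)"
    by (auto simp: cech_group_def)
  then have U: "fin_open_cover ?X \<U>" and z: "z \<in> cocycles ?X G \<U> (Suc n)"
    by (auto simp: G.cech_reps_iff)
  obtain \<V> where V: "\<And>i. i \<in> {..<k} \<Longrightarrow> fin_open_cover (Y i) (\<V> i)"
    and VU: "\<And>V. (\<And>i. i \<in> {..<k} \<Longrightarrow> V i \<in> \<V> i) \<Longrightarrow> \<exists>U\<in>\<U>. PiE {..<k} V \<subseteq> U"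
    by (rule box_refinement[of "{..<k}" Y \<U>]) (use assms(2) U in auto)
  \<comment> \<open>Bundled so that one application of choice supplies index sets and functions for
    all factors together.\<close>
  define Q where "Q i I g \<longleftrightarrow> coloured_partition (Y i) (nd i) (\<lambda>S. card S - 1) I g \<and>
      (\<forall>S\<in>I. \<exists>V\<in>\<V> i. {x\<in>topspace (Y i). 0 < g S x} \<subseteq> V)"
    for i I and g :: "'a set set \<Rightarrow> 'a \<Rightarrow> real"
  have "\<exists>I g. Q i I g" if "i < k" for i
  proof -
    have "metrizable_space (Y i)" "cover_dim_le (Y i) (nd i)" "fin_open_cover (Y i) (\<V> i)"
      using assms(2,3) V that by (auto simp: cover_dim_eq_def)
    then obtain I and g :: "'a set set \<Rightarrow> 'a \<Rightarrow> real" where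
      "coloured_partition (Y i) (nd i) (\<lambda>S. card S - 1) I g"
      "\<forall>S\<in>I. \<exists>V\<in>\<V> i. {x\<in>topspace (Y i). 0 < g S x} \<subseteq> V"
      by (rule coloured_partition_exists)
    then show ?thesis unfolding Q_def by (intro exI conjI)
  qed
  then obtain I g where "\<And>i. i < k \<Longrightarrow> Q i (I i) (g i)" by metis
  then have part: "\<And>i. i < k \<Longrightarrow> coloured_partition (Y i) (nd i) (\<lambda>S. card S - 1) (I i) (g i)"
    and gV: "\<And>i S. i < k \<Longrightarrow> S \<in> I i \<Longrightarrow> \<exists>V\<in>\<V> i. {x\<in>topspace (Y i). 0 < g i S x} \<subseteq> V"
    unfolding Q_def by simp_all
  interpret S: staircase k Y nd "\<lambda>S. card S - 1" I g by unfold_locales (rule part)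
  have "\<forall>W\<in>S.stairs. \<exists>U. U \<in> \<U> \<and> W \<subseteq> U" using S.stairs_refine[OF gV VU] by blast
  then obtain r where r: "refine_proj S.stairs \<U> r" unfolding refine_proj_def by metis
  let ?w = "pull_cochain ?X G S.stairs (Suc n) r z"
  have Aw: "A = cech_class ?X G (Suc n) (S.stairs, ?w)"
    using G.cech_class_refine[OF Uz(1) S.fin_open_cover_stairs r] Uz(2) by simp
  have w: "?w \<in> cocycles ?X G S.stairs (Suc n)"
    using G.pull_cocycle[OF refine_proj_along[OF r] _ z] by simp
  have bal: "balanced ?X S.stairs S.col (Suc n)" using S.balanced_stairs n by simp
  have "\<exists>\<gamma>\<in>nerve_tuples ?X S.stairs (Suc n). \<exists>a\<in>carrier G.
      cech_class ?X G (Suc n) (S.stairs, G.elementary ?X S.stairs S.col (Suc n) \<gamma> a) \<notin> H"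
  proof (rule ccontr)
    assume "\<not> ?thesis"
    then have "A \<in> H"
      unfolding Aw by (intro G.cech_class_balanced_in_subgroup[OF H S.fin_open_cover_stairs bal w]) metis
    then show False using A(2) by contradiction
  qed
  then obtain \<gamma> a where \<gamma>: "\<gamma> \<in> nerve_tuples ?X S.stairs (Suc n)" "a \<in> carrier G"
    and nH: "cech_class ?X G (Suc n) (S.stairs, G.elementary ?X S.stairs S.col (Suc n) \<gamma> a) \<notin> H"
    by (elim bexE)
  obtain \<phi> where \<phi>: "\<forall>i<k. continuous_map (Y i) (sphere_top (nd i)) (\<phi> i)"
    and im: "cech_class ?X G (Suc n) (S.stairs, G.elementary ?X S.stairs S.col (Suc n) \<gamma> a)
      \<in> cech_hom ?X ?Z G (Suc n) (\<lambda>y. \<lambda>i\<in>{..<k}. \<phi> i (y i)) ` carrier (cech_group ?Z G (Suc n))"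
    by (rule S.elementary_class_in_sphere_image[OF assms(4) n \<gamma>])
  show ?thesis
    unfolding n using \<phi> im nH by blast
qed

end
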